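(* Let $T>0$ and $n\in\mathbb{N}$. Let $f:\mathbb{R}\times\mathbb{R}\to\mathbb{R}$, $(x,u)\mapsto f(x,u)$, be such that: (1) $f$ and its partial derivative $f_u$ are Carathéodory functions on $\mathbb{R}\times\mathbb{R}$, and $f(x+T,u)=f(x,u)$ for all $(x,u)\in\mathbb{R}\times\mathbb{R}$; (2) there exist functions $\alpha,\beta\in L^\infty(0,T)$ satisfying $$\lambda_{2n-1}\prec\alpha,\qquad \alpha(x)\le f_u(x,u)\le\beta(x)\ \text{ for a.e. } x\in(0,T)\text{ and all }u\in\mathbb{R},\qquad \|\beta\|_{L^1(0,T)}\le\gamma_{1,n}.$$ Then the problem $$u''(x)+f(x,u(x))=0,\ x\in(0,T),\qquad u(0)-u(T)=u'(0)-u'(T)=0,$$ has a unique solution.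
   Context: $\mathbb{N}=\{1,2,\dots\}$. For $c,d\in L^1(0,T)$, $c\prec d$ means $c(x)\le d(x)$ for a.e. $x\in[0,T]$ and $c(x)<d(x)$ on a set of positive measure (constants are regarded as constant functions). $\lambda_{2n-1}=(2n)^2\pi^2/T^2$ and $$\gamma_{1,n}=T\lambda_{2n-1}+\frac{8\pi n(n+1)}{T}\cot\frac{n\pi}{2(n+1)}.$$ A function $g:\mathbb{R}\times\mathbb{R}\to\mathbb{R}$ is Carathéodory if $g(\cdot,u)$ is measurable for every $u$, $g(x,\cdot)$ is continuous for a.e. $x$, and for every $r>0$ there is a function $h_r$, integrable on bounded intervals, with $|g(x,u)|\le h_r(x)$ for a.e. $x$ and all $|u|\le r$. Solutions are $C^1$ functions on $[0,T]$ with absolutely continuous derivative satisfying the equation a.e. *)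

theory Defs
  imports "HOL-Analysis.Analysis"
begin

text \<open>Almost-everywhere statements and measurability refer to (complete) Lebesgue measure.
  Functions of \<open>(x, u)\<close> are curried, so \<open>g x\<close> is the partial function \<open>u \<mapsto> g(x, u)\<close>.\<close>

definition caratheodory_fun :: "(real \<Rightarrow> real \<Rightarrow> real) \<Rightarrow> bool" where
  "caratheodory_fun g \<longleftrightarrow>
     (\<forall>u. (\<lambda>x. g x u) \<in> borel_measurable lebesgue) \<and>
     (AE x in lebesgue. continuous_on UNIV (g x)) \<and>
     (\<forall>r>0. \<exists>h. (\<forall>a b. set_integrable lebesgue {a..b} h) \<and>
        (AE x in lebesgue. \<forall>u. \<bar>u\<bar> \<le> r \<longrightarrow> \<bar>g x u\<bar> \<le> h x))"

text \<open>Membership in \<open>L\<^sup>\<infinity>(0,T)\<close>, for a representative defined on all of \<open>\<real>\<close>.\<close>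

definition Linfty :: "real \<Rightarrow> (real \<Rightarrow> real) \<Rightarrow> bool" where
  "Linfty T a \<longleftrightarrow>
     a \<in> borel_measurable (lebesgue_on {0<..<T}) \<and>
     (\<exists>C. AE x in lebesgue_on {0<..<T}. \<bar>a x\<bar> \<le> C)"

definition L1_norm :: "real \<Rightarrow> (real \<Rightarrow> real) \<Rightarrow> real" where
  "L1_norm T a = (LINT x|lebesgue_on {0<..<T}. \<bar>a x\<bar>)"

text \<open>The relation \<open>c \<prec> d\<close>. It is meant for \<open>c\<close> and \<open>d\<close> in \<open>L\<^sup>1(0,T)\<close>; the set where
  \<open>c < d\<close> is then Lebesgue measurable, so that its \<^const>\<open>emeasure\<close> is meaningful.\<close>

definition strictly_below :: "real \<Rightarrow> (real \<Rightarrow> real) \<Rightarrow> (real \<Rightarrow> real) \<Rightarrow> bool" where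
  "strictly_below T c d \<longleftrightarrow>
     (AE x in lebesgue_on {0..T}. c x \<le> d x) \<and>
     emeasure lebesgue {x \<in> {0..T}. c x < d x} > 0"

text \<open>\<open>lam_odd T n\<close> is \<open>\<lambda>\<^bsub>2n-1\<^esub>\<close> and \<open>gamma1 T n\<close> is \<open>\<gamma>\<^bsub>1,n\<^esub>\<close>.\<close>

definition lam_odd :: "real \<Rightarrow> nat \<Rightarrow> real" where
  "lam_odd T n = (2 * real n)^2 * pi^2 / T^2"

definition gamma1 :: "real \<Rightarrow> nat \<Rightarrow> real" where
  "gamma1 T n = T * lam_odd T n
     + 8 * pi * real n * (real n + 1) / T * cot (real n * pi / (2 * (real n + 1)))"

text \<open>The usual \<open>\<epsilon>\<close>-\<open>\<delta>\<close> definition of absolute continuity of a function on a compact interval,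
  over finite families of non-overlapping subintervals. It is unrelated to
  \<^const>\<open>absolutely_continuous\<close>, which is about measures.\<close>

definition abs_continuous_on_interval :: "real \<Rightarrow> real \<Rightarrow> (real \<Rightarrow> real) \<Rightarrow> bool" where
  "abs_continuous_on_interval a b F \<longleftrightarrow>
     (\<forall>\<epsilon>>0. \<exists>\<delta>>0. \<forall>(m::nat) s t.
        (\<forall>i<m. a \<le> s i \<and> s i \<le> t i \<and> t i \<le> b) \<longrightarrow>
        (\<forall>i<m. \<forall>j<m. i \<noteq> j \<longrightarrow> {s i<..<t i} \<inter> {s j<..<t j} = {}) \<longrightarrow>
        (\<Sum>i<m. t i - s i) < \<delta> \<longrightarrow>
        (\<Sum>i<m. \<bar>F (t i) - F (s i)\<bar>) < \<epsilon>)"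

text \<open>Solutions of the periodic problem. Here \<open>u'\<close> is the derivative of \<open>u\<close> on \<open>[0,T]\<close>,
  one-sided at the end points. Only the restriction of \<open>u\<close> to \<open>[0,T]\<close> matters.\<close>

definition periodic_solution ::
    "real \<Rightarrow> (real \<Rightarrow> real \<Rightarrow> real) \<Rightarrow> (real \<Rightarrow> real) \<Rightarrow> bool" where
  "periodic_solution T f u \<longleftrightarrow>
     (\<exists>u'. (\<forall>x\<in>{0..T}. (u has_real_derivative u' x) (at x within {0..T})) \<and>
        continuous_on {0..T} u' \<and>
        abs_continuous_on_interval 0 T u' \<and>
        (AE x in lebesgue_on {0<..<T}.
           \<exists>w. (u' has_real_derivative w) (at x) \<and> w + f x (u x) = 0) \<and>
        u 0 - u T = 0 \<and> u' 0 - u' T = 0)"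

end

theory Submission
  imports Defs
begin

text \<open>
  Put \<open>\<mu> = 2 n \<pi> / T\<close>, so that \<open>\<lambda> = \<mu>\<^sup>2\<close> and every nonzero solution of \<open>w'' + \<mu>\<^sup>2 w = 0\<close> makes exactly
  \<open>n\<close> turns of the phase plane \<open>(w'/\<mu>, w)\<close> during one period. The difference \<open>w\<close> of two solutions of
  the nonlinear equation satisfies \<open>w'' + a w = 0\<close> with a coefficient \<open>\<alpha> \<le> a \<le> \<beta>\<close>, and in Pruefer
  coordinates \<open>w = r sin \<theta>\<close>, \<open>w' = \<mu> r cos \<theta>\<close> (lemma \<open>pruefer_angle\<close>) this is the scalar equation
  \<open>\<theta>' = \<mu> + (a - \<mu>\<^sup>2) / \<mu> * sin\<^sup>2 \<theta>\<close>. The two hypotheses on \<open>\<alpha>\<close> and \<open>\<beta>\<close> confine the total rotation of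
  \<open>w\<close> strictly between \<open>n\<close> and \<open>n + 1\<close> turns.

  Since \<open>a \<ge> \<mu>\<^sup>2\<close>, and \<open>\<alpha> > \<mu>\<^sup>2\<close> on a set of positive measure, the rotation is more than \<open>2 n \<pi>\<close>, by an
  amount independent of the solution (lemma \<open>rotation_excess\<close>): \<open>\<theta>\<close> crosses the zeros of \<open>sin\<close>
  with speed at least \<open>\<mu>\<close>, so \<open>sin\<^sup>2 \<theta>\<close> cannot suppress all of the mass of \<open>\<alpha> - \<mu>\<^sup>2\<close>.

  For the upper bound (lemma \<open>rotation_deficit\<close>) let \<open>\<delta> = n \<pi> / (2 (n + 1))\<close>, which is \<open>\<mu>\<close> times the mean
  duration of a quarter turn if \<open>n + 1\<close> turns are made in time \<open>T\<close>. The weight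
  \<open>h \<theta> = \<mu> / max (sin\<^sup>2 \<delta>) (sin\<^sup>2 \<theta>)\<close> satisfies the pointwise inequality
  \<open>h \<theta> * \<theta>' \<le> \<mu>\<^sup>2 / sin\<^sup>2 \<delta> + (a - \<mu>\<^sup>2)\<close>, whatever \<open>a \<ge> \<mu>\<^sup>2\<close> is. Integrating it over \<open>[0, T]\<close> bounds
  the integral of \<open>h\<close> over the range of \<open>\<theta>\<close>, and \<open>\<gamma>\<close> is exactly the value of the integral of \<open>\<beta>\<close> for
  which this bound equals the integral of \<open>h\<close> over \<open>n + 1\<close> turns. A slight tilt of the weight keeps
  the pointwise inequality but increases the integral over a turn, so \<open>n + 1\<close> turns are missed by a
  fixed amount even if \<open>\<beta>\<close> has norm \<open>\<gamma>\<close>. The partition of the period at the zeros of \<open>w\<close> and \<open>w'\<close> and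
  the convexity of \<open>cot\<close>, which the classical argument uses, are absorbed into the weight.

  The phase vector of \<open>w\<close> thus rotates by an angle that keeps a fixed distance from the multiples of
  \<open>2 \<pi>\<close>, so it is displaced by at least \<open>c\<close> times its initial length (lemma \<open>displacement_bound\<close>). In
  other words, the map \<open>F\<close> of the plane that sends initial data to their displacement after time \<open>T\<close>
  satisfies \<open>dist (F x) (F y) \<ge> c * dist x y\<close>. Periodic solutions are the zeros of \<open>F\<close>, so there is at
  most one. There is one because \<open>F\<close> is onto: it is continuous and injective, so its range is open by
  invariance of domain, and the lower bound makes the range closed.

  The bounds \<open>\<alpha>\<close> and \<open>\<beta>\<close> are essentially bounded, so \<open>f x\<close> is Lipschitz with one constant for almost all
  \<open>x\<close>. Initial value problems are therefore uniquely solvable by contraction, and all quantities built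
  from the difference of two solutions are Lipschitz functions of \<open>x\<close> with known derivatives almost
  everywhere. The gauge integral recovers such functions from their derivatives.
\<close>

section \<open>Absolutely continuous functions and the fundamental theorem of calculus\<close>

text \<open>The gauge integral makes this a direct consequence of the two definitions. Around a point where
  \<open>F\<close> is differentiable the gauge enforces the linear approximation of \<open>F\<close>; around a point of \<open>N\<close> it
  enforces that the interval lies in an open set of small measure that covers \<open>N\<close>, and absolute
  continuity makes the total increment of \<open>F\<close> over those intervals small. Integrability of \<open>g\<close> is
  part of the conclusion.\<close>

lemma abs_continuous_FTC:
  fixes F g :: "real \<Rightarrow> real"
  assumes ac: "abs_continuous_on_interval a b F" and ab: "a \<le> b" and N: "negligible N"
    and der: "\<And>x. x \<in> {a..b} - N \<Longrightarrow> (F has_real_derivative g x) (at x within {a..b})"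
  shows "(g has_integral (F b - F a)) {a..b}"
proof -
  \<comment> \<open>Tags in \<open>N\<close> then contribute only the increments of \<open>F\<close> to the error.\<close>
  define g0 where "g0 x = (if x \<in> N then 0 else g x)" for x
  have "(g0 has_integral (F b - F a)) {a..b}"
    unfolding has_integral_real
  proof (intro allI impI)
    fix e :: real assume e: "e > 0"
    define \<eta> where "\<eta> = e / 3 / (b - a + 1)"
    have \<eta>: "\<eta> > 0" using e ab by (auto simp: \<eta>_def)
    have "\<eta> * (b - a) \<le> \<eta> * (b - a + 1)" using \<eta> by simp
    also have "\<dots> = e / 3" using ab unfolding \<eta>_def by (subst times_divide_eq_left, subst nonzero_mult_div_cancel_right) auto
    finally have \<eta>b: "\<eta> * (b - a) < e / 2" using e by simp
    from e have "e / 2 > 0" by simp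
    from ac[unfolded abs_continuous_on_interval_def, THEN spec, THEN mp, OF this]
    obtain \<delta> where \<delta>: "\<delta> > 0" and ac': "\<forall>(m::nat) s t.
        (\<forall>i<m. a \<le> s i \<and> s i \<le> t i \<and> t i \<le> b) \<longrightarrow>
        (\<forall>i<m. \<forall>j<m. i \<noteq> j \<longrightarrow> {s i<..<t i} \<inter> {s j<..<t j} = {}) \<longrightarrow>
        (\<Sum>i<m. t i - s i) < \<delta> \<longrightarrow> (\<Sum>i<m. \<bar>F (t i) - F (s i)\<bar>) < e / 2"
      by (elim exE conjE)
    obtain U where U: "open U" "N \<subseteq> U" and Um: "U \<in> lmeasurable" "measure lebesgue U < \<delta>"
    proof -
      have Ns: "N \<in> null_sets lebesgue" using N by (simp add: negligible_iff_null_sets)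
      then obtain U where U: "open U" "N \<subseteq> U" "U - N \<in> lmeasurable" "emeasure lebesgue (U - N) < ennreal \<delta>"
        using sets_lebesgue_outer_open[of N \<delta>] \<delta> by (metis null_setsD2)
      have eq: "emeasure lebesgue U = emeasure lebesgue (U - N)"
        using emeasure_Diff_null_set[OF Ns, of U] U(1) by simp
      have "U \<in> lmeasurable" using U eq by (intro fmeasurableI) (auto intro: order.strict_trans[OF _ ennreal_less_top])
      moreover have "measure lebesgue U < \<delta>"
        using U(4) eq \<delta> by (metis Sigma_Algebra.measure_def enn2real_less_iff ennreal_less_top order.strict_trans)
      ultimately show thesis using U that by blast
    qed
    have "\<exists>d>0. \<forall>y\<in>{a..b}. \<bar>y - x\<bar> < d \<longrightarrow> \<bar>F y - F x - g x * (y - x)\<bar> \<le> \<eta> * \<bar>y - x\<bar>"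
      if "x \<in> {a..b} - N" for x
      using der[OF that] \<eta> unfolding has_field_derivative_def has_derivative_within_alt
      by (auto simp: norm_mult)
    then obtain d where d: "\<And>x. x \<in> {a..b} - N \<Longrightarrow> d x > 0"
      "\<And>x y. x \<in> {a..b} - N \<Longrightarrow> y \<in> {a..b} \<Longrightarrow> \<bar>y - x\<bar> < d x \<Longrightarrow> \<bar>F y - F x - g x * (y - x)\<bar> \<le> \<eta> * \<bar>y - x\<bar>"
      by metis
    \<comment> \<open>At tags in \<open>N\<close> the gauge is the open set \<open>U\<close> itself.\<close>
    define \<gamma> where "\<gamma> x = (if x \<in> N then U else if x \<in> {a..b} then ball x (d x) else UNIV)" for x
    have gauge: "gauge \<gamma>"
      unfolding gauge_def \<gamma>_def using U d(1) by auto
    show "\<exists>\<gamma>. gauge \<gamma> \<and> (\<forall>D. D tagged_division_of {a..b} \<and> \<gamma> fine D \<longrightarrow>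
            norm ((\<Sum>(x,k)\<in>D. measure lborel k *\<^sub>R g0 x) - (F b - F a)) < e)"
    proof (intro exI[of _ \<gamma>] conjI allI impI gauge)
      fix D assume "D tagged_division_of {a..b} \<and> \<gamma> fine D"
      then have D: "D tagged_division_of {a..b}" and fine: "\<gamma> fine D" by auto
      have fin: "finite D" using D by auto
      have fine': "k \<subseteq> \<gamma> x" if "(x, k) \<in> D" for x k using fine that unfolding fine_def by blast
      have shape: "k = {Inf k..Sup k} \<and> Inf k \<le> Sup k \<and> x \<in> k \<and> k \<subseteq> {a..b} \<and> measure lborel k = Sup k - Inf k"
        if xk: "(x, k) \<in> D" for x k
      proof -
        obtain u v where k: "k = cbox u v" using tagged_division_ofD(4)[OF D xk] by blast
        moreover have x: "x \<in> k" "k \<subseteq> {a..b}" using tagged_division_ofD(2,3)[OF D xk] by auto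
        ultimately show ?thesis by auto
      qed
      define h where "h p = measure lborel (snd p) *\<^sub>R g0 (fst p) - (F (Sup (snd p)) - F (Inf (snd p)))" for p
      have tel: "(\<Sum>(x,k)\<in>D. F (Sup k) - F (Inf k)) = F b - F a"
        using additive_tagged_division_1[OF ab D] .
      have eq: "(\<Sum>(x,k)\<in>D. measure lborel k *\<^sub>R g0 x) - (F b - F a) = sum h D"
        unfolding tel[symmetric] sum_subtractf[symmetric] h_def by (auto intro!: sum.cong)
      \<comment> \<open>\<open>h p\<close> is the error of the tagged interval \<open>p\<close>; it is estimated by differentiability for tags
        outside of \<open>N\<close> and by absolute continuity for tags in \<open>N\<close>.\<close>
      define D1 where "D1 = {p \<in> D. fst p \<notin> N}"
      define D2 where "D2 = {p \<in> D. fst p \<in> N}"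
      have split: "sum h D = sum h D1 + sum h D2"
        using fin unfolding D1_def D2_def
        by (subst sum.union_disjoint[symmetric]) (auto intro!: sum.cong)
      have b1: "\<bar>sum h D1\<bar> \<le> \<eta> * (b - a)"
      proof -
        have "\<bar>sum h D1\<bar> \<le> (\<Sum>p\<in>D1. \<eta> * measure lborel (snd p))"
        proof (rule order_trans[OF sum_abs], rule sum_mono)
          fix p assume p: "p \<in> D1"
          obtain x k where pk: "p = (x, k)" by (cases p)
          have xk: "(x,k) \<in> D" "x \<notin> N" using p pk D1_def by auto
          note s = shape[OF xk(1)]
          have xab: "x \<in> {a..b} - N" using s xk by auto
          have kb: "k \<subseteq> ball x (d x)" using fine'[OF xk(1)] xk(2) xab by (simp add: \<gamma>_def)
          have I: "Inf k \<in> k" "Sup k \<in> k" using s by (metis atLeastAtMost_iff order_refl)+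
          have len: "measure lborel k = Sup k - Inf k" using s by blast
          have near: "\<bar>y - x\<bar> < d x" if "y \<in> k" for y
            using kb that by (auto simp: dist_real_def abs_minus_commute subset_iff)
          have n: "\<bar>F (Sup k) - F x - g x * (Sup k - x)\<bar> \<le> \<eta> * \<bar>Sup k - x\<bar>"
            "\<bar>F (Inf k) - F x - g x * (Inf k - x)\<bar> \<le> \<eta> * \<bar>Inf k - x\<bar>"
            using I s near by (auto intro!: d(2)[OF xab])
          have a: "\<bar>Sup k - x\<bar> = Sup k - x" "\<bar>Inf k - x\<bar> = x - Inf k"
            using s by (metis abs_of_nonneg atLeastAtMost_iff diff_ge_0_iff_ge abs_minus_commute)+
          have "h p = (Sup k - Inf k) * g x - (F (Sup k) - F (Inf k))"
            using xk(2) unfolding h_def pk g0_def fst_conv snd_conv len by simp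
          then have "h p = (F (Inf k) - F x - g x * (Inf k - x)) - (F (Sup k) - F x - g x * (Sup k - x))"
            by (simp add: algebra_simps)
          then have "\<bar>h p\<bar> \<le> \<eta> * (Sup k - x) + \<eta> * (x - Inf k)"
            using add_mono[OF n(2)[unfolded a] n(1)[unfolded a]] abs_triangle_ineq4[of "F (Inf k) - F x - g x * (Inf k - x)"
              "F (Sup k) - F x - g x * (Sup k - x)"] by (metis add.commute order_trans)
          also have "\<dots> = \<eta> * measure lborel (snd p)" unfolding pk snd_conv len by (simp add: algebra_simps)
          finally show "\<bar>h p\<bar> \<le> \<eta> * measure lborel (snd p)" .
        qed
        also have "\<dots> \<le> (\<Sum>p\<in>D. \<eta> * measure lborel (snd p))"
          using fin \<eta> by (intro sum_mono2) (auto simp: D1_def)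
        also have "\<dots> = \<eta> * (\<Sum>(x,k)\<in>D. measure lborel k)"
          by (simp add: sum_distrib_left case_prod_unfold)
        also have "\<dots> = \<eta> * (b - a)"
          using additive_content_tagged_division[of D a b] D ab by simp
        finally show ?thesis .
      qed
      have b2: "\<bar>sum h D2\<bar> < e / 2"
      proof -
        have fin2: "finite D2" using fin D2_def by auto
        then obtain \<phi> where \<phi>: "bij_betw \<phi> {0..<card D2} D2" using ex_bij_betw_nat_finite by blast
        define m where "m = card D2"
        have \<phi>: "bij_betw \<phi> {..<m} D2" using \<phi> by (simp add: m_def atLeast0LessThan)
        have in2: "(fst (\<phi> i), snd (\<phi> i)) \<in> D" "\<phi> i \<in> D2" if "i < m" for i
          using \<phi> that by (auto simp: bij_betw_def D2_def)
        define s where "s i = Inf (snd (\<phi> i))" for i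
        define t where "t i = Sup (snd (\<phi> i))" for i
        have c1: "\<forall>i<m. a \<le> s i \<and> s i \<le> t i \<and> t i \<le> b"
        proof (intro allI impI)
          fix i assume "i < m"
          note S = shape[OF in2(1)[OF this]]
          then have "s i \<in> snd (\<phi> i)" "t i \<in> snd (\<phi> i)"
            unfolding s_def t_def by (metis atLeastAtMost_iff order_refl)+
          then show "a \<le> s i \<and> s i \<le> t i \<and> t i \<le> b" using S by (auto simp: s_def t_def subset_iff)
        qed
        have int: "interior (snd (\<phi> i)) = {s i<..<t i}" if "i < m" for i
          using shape[OF in2(1)[OF that]] unfolding s_def t_def by (metis interior_atLeastAtMost_real)
        have c2: "\<forall>i<m. \<forall>j<m. i \<noteq> j \<longrightarrow> {s i<..<t i} \<inter> {s j<..<t j} = {}"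
        proof (intro allI impI)
          fix i j assume ij: "i < m" "j < m" "i \<noteq> j"
          then have "\<phi> i \<noteq> \<phi> j" using \<phi> by (auto simp: bij_betw_def inj_on_def)
          then have "interior (snd (\<phi> i)) \<inter> interior (snd (\<phi> j)) = {}"
            using tagged_division_ofD(5)[OF D in2(1)[OF ij(1)] in2(1)[OF ij(2)]] by (metis prod.collapse)
          then show "{s i<..<t i} \<inter> {s j<..<t j} = {}" using int ij by simp
        qed
        have c3: "(\<Sum>i<m. t i - s i) < \<delta>"
        proof -
          have fin_meas: "emeasure lebesgue {s i<..<t i} \<noteq> \<infinity>" if "i < m" for i
            using c1 that by simp
          have "(\<Sum>i<m. t i - s i) = (\<Sum>i<m. measure lebesgue {s i<..<t i})"
            using c1 by (intro sum.cong) auto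
          also have "\<dots> = measure lebesgue (\<Union>i\<in>{..<m}. {s i<..<t i})"
            using c2 fin_meas by (intro measure_finite_Union[symmetric]) (auto simp: disjoint_family_on_def)
          also have "\<dots> \<le> measure lebesgue U"
          proof (rule measure_mono_fmeasurable[OF _ _ Um(1)])
            show "(\<Union>i\<in>{..<m}. {s i<..<t i}) \<subseteq> U"
            proof (rule UN_least)
              fix i assume i: "i \<in> {..<m}"
              have "snd (\<phi> i) \<subseteq> \<gamma> (fst (\<phi> i))" using fine'[OF in2(1)[of i]] i by simp
              moreover have "fst (\<phi> i) \<in> N" using in2(2)[of i] i by (auto simp: D2_def)
              moreover have "{s i<..<t i} \<subseteq> snd (\<phi> i)" using int[of i] i interior_subset by (metis lessThan_iff)
              ultimately show "{s i<..<t i} \<subseteq> U" by (auto simp: \<gamma>_def)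
            qed
          qed auto
          finally show ?thesis using Um by simp
        qed
        have "\<bar>sum h D2\<bar> \<le> (\<Sum>p\<in>D2. \<bar>h p\<bar>)" by (rule sum_abs)
        also have "\<dots> = (\<Sum>i<m. \<bar>h (\<phi> i)\<bar>)" using sum.reindex_bij_betw[OF \<phi>, of "\<lambda>p. \<bar>h p\<bar>"] by simp
        also have "\<dots> = (\<Sum>i<m. \<bar>F (t i) - F (s i)\<bar>)"
          using in2(2) by (intro sum.cong) (auto simp: h_def D2_def g0_def s_def t_def abs_minus_commute)
        also have "\<dots> < e / 2" using ac'[THEN spec, THEN spec, THEN spec, THEN mp, THEN mp, THEN mp, OF c1 c2 c3] .
        finally show ?thesis .
      qed
      show "norm ((\<Sum>(x,k)\<in>D. measure lborel k *\<^sub>R g0 x) - (F b - F a)) < e"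
        unfolding eq split using b1 b2 \<eta>b by auto
    qed
  qed
  then show ?thesis
    by (rule has_integral_spike[OF N, rotated]) (auto simp: g0_def)
qed

lemma abs_continuous_on_subinterval:
  assumes "abs_continuous_on_interval a b F" "a \<le> c" "d \<le> b"
  shows "abs_continuous_on_interval c d F"
  unfolding abs_continuous_on_interval_def
proof (intro allI impI)
  fix e :: real assume "e > 0"
  from assms(1)[unfolded abs_continuous_on_interval_def, THEN spec, THEN mp, OF this]
  obtain \<delta> where \<delta>: "\<delta> > 0" and *: "\<forall>(m::nat) s t.
        (\<forall>i<m. a \<le> s i \<and> s i \<le> t i \<and> t i \<le> b) \<longrightarrow>
        (\<forall>i<m. \<forall>j<m. i \<noteq> j \<longrightarrow> {s i<..<t i} \<inter> {s j<..<t j} = {}) \<longrightarrow>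
        (\<Sum>i<m. t i - s i) < \<delta> \<longrightarrow> (\<Sum>i<m. \<bar>F (t i) - F (s i)\<bar>) < e"
    by (elim exE conjE)
  show "\<exists>\<delta>>0. \<forall>(m::nat) s t.
        (\<forall>i<m. c \<le> s i \<and> s i \<le> t i \<and> t i \<le> d) \<longrightarrow>
        (\<forall>i<m. \<forall>j<m. i \<noteq> j \<longrightarrow> {s i<..<t i} \<inter> {s j<..<t j} = {}) \<longrightarrow>
        (\<Sum>i<m. t i - s i) < \<delta> \<longrightarrow> (\<Sum>i<m. \<bar>F (t i) - F (s i)\<bar>) < e"
  proof (intro exI[of _ \<delta>] conjI \<delta> allI impI)
    fix m :: nat and s t
    assume 1: "\<forall>i<m. c \<le> s i \<and> s i \<le> t i \<and> t i \<le> d"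
      and 2: "\<forall>i<m. \<forall>j<m. i \<noteq> j \<longrightarrow> {s i<..<t i} \<inter> {s j<..<t j} = {}"
      and 3: "(\<Sum>i<m. t i - s i) < \<delta>"
    have "\<forall>i<m. a \<le> s i \<and> s i \<le> t i \<and> t i \<le> b" using 1 assms by force
    from *[THEN spec, THEN spec, THEN spec, THEN mp, THEN mp, THEN mp, OF this 2 3]
    show "(\<Sum>i<m. \<bar>F (t i) - F (s i)\<bar>) < e" .
  qed
qed

lemma abs_continuous_on_diff:
  assumes "abs_continuous_on_interval a b F" "abs_continuous_on_interval a b G"
  shows "abs_continuous_on_interval a b (\<lambda>x. F x - G x)"
  unfolding abs_continuous_on_interval_def
proof (intro allI impI)
  fix e :: real assume "e > 0"
  then have e2: "e / 2 > 0" by simp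
  from assms(1)[unfolded abs_continuous_on_interval_def, THEN spec, THEN mp, OF this]
  obtain \<delta> where \<delta>: "\<delta> > 0" and F: "\<forall>(m::nat) s t.
        (\<forall>i<m. a \<le> s i \<and> s i \<le> t i \<and> t i \<le> b) \<longrightarrow>
        (\<forall>i<m. \<forall>j<m. i \<noteq> j \<longrightarrow> {s i<..<t i} \<inter> {s j<..<t j} = {}) \<longrightarrow>
        (\<Sum>i<m. t i - s i) < \<delta> \<longrightarrow> (\<Sum>i<m. \<bar>F (t i) - F (s i)\<bar>) < e / 2"
    by (elim exE conjE)
  from assms(2)[unfolded abs_continuous_on_interval_def, THEN spec, THEN mp, OF e2]
  obtain \<delta>' where \<delta>': "\<delta>' > 0" and G: "\<forall>(m::nat) s t.
        (\<forall>i<m. a \<le> s i \<and> s i \<le> t i \<and> t i \<le> b) \<longrightarrow>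
        (\<forall>i<m. \<forall>j<m. i \<noteq> j \<longrightarrow> {s i<..<t i} \<inter> {s j<..<t j} = {}) \<longrightarrow>
        (\<Sum>i<m. t i - s i) < \<delta>' \<longrightarrow> (\<Sum>i<m. \<bar>G (t i) - G (s i)\<bar>) < e / 2"
    by (elim exE conjE)
  show "\<exists>\<delta>>0. \<forall>(m::nat) s t.
        (\<forall>i<m. a \<le> s i \<and> s i \<le> t i \<and> t i \<le> b) \<longrightarrow>
        (\<forall>i<m. \<forall>j<m. i \<noteq> j \<longrightarrow> {s i<..<t i} \<inter> {s j<..<t j} = {}) \<longrightarrow>
        (\<Sum>i<m. t i - s i) < \<delta> \<longrightarrow> (\<Sum>i<m. \<bar>(F (t i) - G (t i)) - (F (s i) - G (s i))\<bar>) < e"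
  proof (intro exI[of _ "min \<delta> \<delta>'"] conjI allI impI)
    fix m :: nat and s t
    assume 1: "\<forall>i<m. a \<le> s i \<and> s i \<le> t i \<and> t i \<le> b"
      and 2: "\<forall>i<m. \<forall>j<m. i \<noteq> j \<longrightarrow> {s i<..<t i} \<inter> {s j<..<t j} = {}"
      and 3: "(\<Sum>i<m. t i - s i) < min \<delta> \<delta>'"
    have "(\<Sum>i<m. \<bar>(F (t i) - G (t i)) - (F (s i) - G (s i))\<bar>)
        \<le> (\<Sum>i<m. \<bar>F (t i) - F (s i)\<bar>) + (\<Sum>i<m. \<bar>G (t i) - G (s i)\<bar>)"
      unfolding sum.distrib[symmetric] by (intro sum_mono) linarith
    also have "\<dots> < e / 2 + e / 2"
      using F[THEN spec, THEN spec, THEN spec, THEN mp, THEN mp, THEN mp, OF 1 2]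
        G[THEN spec, THEN spec, THEN spec, THEN mp, THEN mp, THEN mp, OF 1 2] 3
      by (intro add_strict_mono) simp_all
    finally show "(\<Sum>i<m. \<bar>(F (t i) - G (t i)) - (F (s i) - G (s i))\<bar>) < e" by simp
  qed (use \<delta> \<delta>' in simp)
qed

lemma lipschitz_imp_abs_continuous:
  fixes F :: "real \<Rightarrow> real"
  assumes "L-lipschitz_on {a..b} F"
  shows "abs_continuous_on_interval a b F"
  unfolding abs_continuous_on_interval_def
proof (intro allI impI)
  fix e :: real assume e: "e > 0"
  have L: "L \<ge> 0" using assms lipschitz_on_nonneg by blast
  show "\<exists>\<delta>>0. \<forall>(m::nat) s t.
        (\<forall>i<m. a \<le> s i \<and> s i \<le> t i \<and> t i \<le> b) \<longrightarrow>
        (\<forall>i<m. \<forall>j<m. i \<noteq> j \<longrightarrow> {s i<..<t i} \<inter> {s j<..<t j} = {}) \<longrightarrow>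
        (\<Sum>i<m. t i - s i) < \<delta> \<longrightarrow> (\<Sum>i<m. \<bar>F (t i) - F (s i)\<bar>) < e"
  proof (intro exI[of _ "e / (L + 1)"] conjI allI impI)
    fix m :: nat and s t
    assume 1: "\<forall>i<m. a \<le> s i \<and> s i \<le> t i \<and> t i \<le> b"
      and 3: "(\<Sum>i<m. t i - s i) < e / (L + 1)"
    have "(\<Sum>i<m. \<bar>F (t i) - F (s i)\<bar>) \<le> (\<Sum>i<m. (L + 1) * (t i - s i))"
    proof (rule sum_mono)
      fix i assume "i \<in> {..<m}"
      then have i: "a \<le> s i" "s i \<le> t i" "t i \<le> b" using 1 by auto
      have "\<bar>F (t i) - F (s i)\<bar> \<le> L * (t i - s i)"
        using lipschitz_onD[OF assms, of "t i" "s i"] i by (auto simp: dist_real_def)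
      also have "\<dots> \<le> (L + 1) * (t i - s i)" using i by (intro mult_right_mono) auto
      finally show "\<bar>F (t i) - F (s i)\<bar> \<le> (L + 1) * (t i - s i)" .
    qed
    also have "\<dots> = (L + 1) * (\<Sum>i<m. t i - s i)" by (simp add: sum_distrib_left)
    also have "\<dots> < e" using 3 L by (simp add: pos_less_divide_eq mult.commute)
    finally show "(\<Sum>i<m. \<bar>F (t i) - F (s i)\<bar>) < e" .
  qed (use e L in simp)
qed

section \<open>Lipschitz functions with almost everywhere derivatives\<close>

text \<open>The derivatives are one-sided at the end points, and \<open>g\<close> is determined only almost everywhere.
  This class is closed under sums, products and composition with continuously differentiable
  functions, which makes it a convenient substitute for absolutely continuous functions.\<close>

definition lip_deriv :: "real \<Rightarrow> (real \<Rightarrow> real) \<Rightarrow> (real \<Rightarrow> real) \<Rightarrow> bool" where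
  "lip_deriv T F g \<longleftrightarrow> (\<exists>L. L-lipschitz_on {0..T} F) \<and>
     (\<exists>N. negligible N \<and> (\<forall>x\<in>{0..T} - N. (F has_real_derivative g x) (at x within {0..T})))"

lemma continuous_on_interval_bounded:
  fixes g :: "real \<Rightarrow> real"
  assumes "continuous_on {a..b} g"
  obtains B where "B > 0" "\<And>x. x \<in> {a..b} \<Longrightarrow> \<bar>g x\<bar> \<le> B"
proof -
  have "bounded (g ` {a..b})" using assms compact_continuous_image compact_imp_bounded by blast
  then obtain B where "\<forall>y\<in>g ` {a..b}. norm y \<le> B" unfolding bounded_iff ..
  then have "\<bar>g x\<bar> \<le> \<bar>B\<bar> + 1" if "x \<in> {a..b}" for x using that by force
  then show thesis using that[of "\<bar>B\<bar> + 1"] by auto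
qed

lemma lip_derivI:
  assumes "L-lipschitz_on {0..T} F" "negligible N"
    "\<And>x. x \<in> {0..T} - N \<Longrightarrow> (F has_real_derivative g x) (at x within {0..T})"
  shows "lip_deriv T F g"
  using assms unfolding lip_deriv_def by blast

lemma lip_derivE:
  assumes "lip_deriv T F g"
  obtains L N where "L \<ge> 0" "L-lipschitz_on {0..T} F" "negligible N"
    "\<And>x. x \<in> {0..T} - N \<Longrightarrow> (F has_real_derivative g x) (at x within {0..T})"
proof -
  from assms obtain L N where L: "L-lipschitz_on {0..T} F" and N: "negligible N"
    "\<forall>x\<in>{0..T} - N. (F has_real_derivative g x) (at x within {0..T})"
    unfolding lip_deriv_def by blast
  show thesis using that[OF lipschitz_on_nonneg[OF L] L N(1)] N(2) by blast
qed

lemma lip_deriv_continuous: "lip_deriv T F g \<Longrightarrow> continuous_on {0..T} F"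
  by (auto simp: lip_deriv_def intro: lipschitz_on_continuous_on)

lemma lip_deriv_bounded:
  assumes "lip_deriv T F g"
  obtains B where "B > 0" "\<And>x. x \<in> {0..T} \<Longrightarrow> \<bar>F x\<bar> \<le> B"
  using continuous_on_interval_bounded[OF lip_deriv_continuous[OF assms]] by blast

lemma lip_deriv_FTC:
  assumes F: "lip_deriv T F g" and st: "0 \<le> s" "s \<le> t" "t \<le> T"
  shows "(g has_integral (F t - F s)) {s..t}"
proof -
  from F obtain L N where L: "L-lipschitz_on {0..T} F" and N: "negligible N"
    and d: "\<And>x. x \<in> {0..T} - N \<Longrightarrow> (F has_real_derivative g x) (at x within {0..T})"
    by (rule lip_derivE) blast
  have sub: "{s..t} \<subseteq> {0..T}" using st by auto
  show ?thesis
  proof (rule abs_continuous_FTC[OF _ st(2) N])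
    show "abs_continuous_on_interval s t F"
      using lipschitz_imp_abs_continuous[OF lipschitz_on_subset[OF L sub]] .
    show "(F has_real_derivative g x) (at x within {s..t})" if "x \<in> {s..t} - N" for x
      using d[of x] that sub by (auto intro: DERIV_subset)
  qed
qed

lemma lip_deriv_C1:
  assumes d: "\<And>x. x \<in> {0..T} \<Longrightarrow> (F has_real_derivative g x) (at x within {0..T})"
    and g: "continuous_on {0..T} g"
  shows "lip_deriv T F g"
proof -
  obtain B where B: "B > 0" "\<And>x. x \<in> {0..T} \<Longrightarrow> \<bar>g x\<bar> \<le> B"
    using continuous_on_interval_bounded[OF g] by blast
  have "B-lipschitz_on {0..T} F"
  proof (rule bounded_derivative_imp_lipschitz)
    show "(F has_derivative (*) (g x)) (at x within {0..T})" if "x \<in> {0..T}" for x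
      using d[OF that] by (simp add: has_field_derivative_def)
    show "onorm ((*) (g x)) \<le> B" if "x \<in> {0..T}" for x
    proof (rule onorm_le)
      fix y
      have "\<bar>g x\<bar> * \<bar>y\<bar> \<le> B * \<bar>y\<bar>" using B(2)[OF that] by (intro mult_right_mono) auto
      then show "norm (g x * y) \<le> B * norm y" by (simp add: abs_mult)
    qed
  qed (use B in auto)
  then show ?thesis using d by (intro lip_derivI[where N="{}"]) auto
qed

lemma lip_deriv_cong_ae:
  assumes "lip_deriv T F g" "negligible N" "\<And>x. x \<in> {0..T} - N \<Longrightarrow> g x = g' x"
  shows "lip_deriv T F g'"
proof -
  from assms(1) obtain L M where L: "L-lipschitz_on {0..T} F" and M: "negligible M"
    and d: "\<And>x. x \<in> {0..T} - M \<Longrightarrow> (F has_real_derivative g x) (at x within {0..T})"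
    by (rule lip_derivE) blast
  show ?thesis
  proof (rule lip_derivI[OF L, of "M \<union> N"])
    show "(F has_real_derivative g' x) (at x within {0..T})" if "x \<in> {0..T} - (M \<union> N)" for x
      using d[of x] assms(3)[of x] that by simp
  qed (use assms M in auto)
qed

lemma lip_deriv_add:
  assumes "lip_deriv T F f" "lip_deriv T G g"
  shows "lip_deriv T (\<lambda>x. F x + G x) (\<lambda>x. f x + g x)"
proof -
  from assms(1) obtain L M where L: "L-lipschitz_on {0..T} F" and M: "negligible M"
    and d: "\<And>x. x \<in> {0..T} - M \<Longrightarrow> (F has_real_derivative f x) (at x within {0..T})"
    by (rule lip_derivE) blast
  from assms(2) obtain L' M' where L': "L'-lipschitz_on {0..T} G" and M': "negligible M'"
    and d': "\<And>x. x \<in> {0..T} - M' \<Longrightarrow> (G has_real_derivative g x) (at x within {0..T})"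
    by (rule lip_derivE) blast
  show ?thesis
    by (rule lip_derivI[OF lipschitz_on_add[OF L L'], of "M \<union> M'"])
      (use d d' M M' in \<open>auto intro!: DERIV_add\<close>)
qed

lemma lip_deriv_mult:
  assumes F: "lip_deriv T F f" and G: "lip_deriv T G g"
  shows "lip_deriv T (\<lambda>x. F x * G x) (\<lambda>x. f x * G x + F x * g x)"
proof -
  obtain B where B: "B > 0" "\<And>x. x \<in> {0..T} \<Longrightarrow> \<bar>F x\<bar> \<le> B" by (rule lip_deriv_bounded[OF F]) blast
  obtain B' where B': "B' > 0" "\<And>x. x \<in> {0..T} \<Longrightarrow> \<bar>G x\<bar> \<le> B'" by (rule lip_deriv_bounded[OF G]) blast
  from F obtain L M where "L \<ge> 0" and L: "L-lipschitz_on {0..T} F" and M: "negligible M"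
    and d: "\<And>x. x \<in> {0..T} - M \<Longrightarrow> (F has_real_derivative f x) (at x within {0..T})"
    by (rule lip_derivE) blast
  from G obtain L' M' where "L' \<ge> 0" and L': "L'-lipschitz_on {0..T} G" and M': "negligible M'"
    and d': "\<And>x. x \<in> {0..T} - M' \<Longrightarrow> (G has_real_derivative g x) (at x within {0..T})"
    by (rule lip_derivE) blast
  have "(L * B' + B * L')-lipschitz_on {0..T} (\<lambda>x. F x * G x)"
  proof (rule lipschitz_onI)
    fix x y assume xy: "x \<in> {0..T}" "y \<in> {0..T}"
    have "\<bar>F x * G x - F y * G y\<bar> = \<bar>(F x - F y) * G x + F y * (G x - G y)\<bar>" by (simp add: algebra_simps)
    also have "\<dots> \<le> \<bar>F x - F y\<bar> * \<bar>G x\<bar> + \<bar>F y\<bar> * \<bar>G x - G y\<bar>"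
      by (metis abs_mult abs_triangle_ineq)
    also have "\<dots> \<le> (L * dist x y) * B' + B * (L' * dist x y)"
      using lipschitz_onD[OF L xy] lipschitz_onD[OF L' xy] xy B B' \<open>L \<ge> 0\<close> \<open>L' \<ge> 0\<close>
      by (intro add_mono mult_mono) (auto simp: dist_real_def)
    finally show "dist (F x * G x) (F y * G y) \<le> (L * B' + B * L') * dist x y"
      by (simp add: dist_real_def algebra_simps)
  qed (use B B' \<open>L \<ge> 0\<close> \<open>L' \<ge> 0\<close> in auto)
  then show ?thesis
  proof (rule lip_derivI[of _ _ _ "M \<union> M'"])
    fix x assume "x \<in> {0..T} - (M \<union> M')"
    then show "((\<lambda>x. F x * G x) has_real_derivative f x * G x + F x * g x) (at x within {0..T})"
      using DERIV_mult[OF d d', of x] by (simp add: mult.commute add.commute)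
  qed (use M M' in auto)
qed

lemma lip_deriv_chain:
  assumes F: "lip_deriv T F f"
    and H: "\<And>y. (H has_real_derivative h y) (at y)" and h: "continuous_on UNIV h"
  shows "lip_deriv T (\<lambda>x. H (F x)) (\<lambda>x. h (F x) * f x)"
proof -
  obtain B where B: "B > 0" "\<And>x. x \<in> {0..T} \<Longrightarrow> \<bar>F x\<bar> \<le> B" by (rule lip_deriv_bounded[OF F]) blast
  from F obtain L M where "L \<ge> 0" and L: "L-lipschitz_on {0..T} F" and M: "negligible M"
    and d: "\<And>x. x \<in> {0..T} - M \<Longrightarrow> (F has_real_derivative f x) (at x within {0..T})"
    by (rule lip_derivE) blast
  obtain C where C: "C > 0" "\<And>x. x \<in> {-B..B} \<Longrightarrow> \<bar>h x\<bar> \<le> C"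
    using continuous_on_interval_bounded[OF continuous_on_subset[OF h subset_UNIV]] by blast
  have "C-lipschitz_on {-B..B} H"
  proof (rule bounded_derivative_imp_lipschitz)
    show "(H has_derivative (*) (h x)) (at x within {-B..B})" if "x \<in> {-B..B}" for x
      using H[of x] by (simp add: has_field_derivative_def has_derivative_at_withinI)
    show "onorm ((*) (h x)) \<le> C" if "x \<in> {-B..B}" for x
    proof (rule onorm_le)
      fix y
      have "\<bar>h x\<bar> * \<bar>y\<bar> \<le> C * \<bar>y\<bar>" using C(2)[OF that] by (intro mult_right_mono) auto
      then show "norm (h x * y) \<le> C * norm y" by (simp add: abs_mult)
    qed
  qed (use C in auto)
  moreover have "F ` {0..T} \<subseteq> {-B..B}" using B(2) by (auto simp: abs_le_iff minus_le_iff)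
  ultimately have "C-lipschitz_on (F ` {0..T}) H" by (rule lipschitz_on_subset)
  from lipschitz_on_compose2[OF L this] show ?thesis
  proof (rule lip_derivI[OF _ M])
    fix x assume "x \<in> {0..T} - M"
    from DERIV_chain2[OF H d[OF this]]
    show "((\<lambda>x. H (F x)) has_real_derivative h (F x) * f x) (at x within {0..T})" .
  qed
qed

lemma lip_deriv_const: "lip_deriv T (\<lambda>x. c) (\<lambda>x. 0)"
  by (rule lip_deriv_C1) (auto intro: derivative_eq_intros)

lemma lip_deriv_cmult:
  assumes "lip_deriv T F f" shows "lip_deriv T (\<lambda>x. c * F x) (\<lambda>x. c * f x)"
  using lip_deriv_mult[OF lip_deriv_const assms] by simp

lemma lip_deriv_diff:
  assumes "lip_deriv T F f" "lip_deriv T G g"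
  shows "lip_deriv T (\<lambda>x. F x - G x) (\<lambda>x. f x - g x)"
  using lip_deriv_add[OF assms(1) lip_deriv_cmult[OF assms(2), of "-1"]] by simp

lemma has_integral_le_ae:
  fixes f g :: "real \<Rightarrow> real"
  assumes "(f has_integral I) S" "(g has_integral J) S" "negligible N"
    and "\<And>x. x \<in> S - N \<Longrightarrow> f x \<le> g x"
  shows "I \<le> J"
proof -
  have "((\<lambda>x. if x \<in> N then g x else f x) has_integral I) S"
    by (rule has_integral_spike[OF assms(3) _ assms(1)]) auto
  then show ?thesis by (rule has_integral_le[OF _ assms(2)]) (use assms(4) in auto)
qed

text \<open>Both \<open>exp (- M x) * E x\<close> and \<open>- exp (M x) * E x\<close> have a nonpositive derivative. The second
  estimate prevents a positive \<open>E\<close> from reaching zero.\<close>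

lemma gronwall:
  assumes E: "lip_deriv T E e" and N: "negligible N"
    and b: "\<And>x. x \<in> {0..T} - N \<Longrightarrow> \<bar>e x\<bar> \<le> M * E x"
    and st: "0 \<le> s" "s \<le> t" "t \<le> T"
  shows "E t \<le> exp (M * (t - s)) * E s" "E s \<le> exp (M * (t - s)) * E t"
proof -
  have X: "lip_deriv T (\<lambda>x. exp (c * x)) (\<lambda>x. exp (c * x) * c)" for c
    by (rule lip_deriv_C1, (rule derivative_eq_intros refl | simp)+) (intro continuous_intros)
  have "exp (-M * t) * E t - exp (-M * s) * E s \<le> 0"
  proof (rule has_integral_le_ae[OF lip_deriv_FTC[OF lip_deriv_mult[OF X E] st] has_integral_0 N])
    fix x assume "x \<in> {s..t} - N"
    then have "exp (- M * x) * (e x - M * E x) \<le> 0"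
      using b[of x] st by (intro mult_nonneg_nonpos) auto
    then show "exp (- M * x) * - M * E x + exp (- M * x) * e x \<le> 0" by (simp add: algebra_simps)
  qed
  then have "exp (M * t) * (exp (-M * t) * E t) \<le> exp (M * t) * (exp (-M * s) * E s)"
    by (intro mult_left_mono) auto
  then have "exp (M * t + - M * t) * E t \<le> exp (M * t + - M * s) * E s"
    by (simp only: mult.assoc[symmetric] mult_exp_exp)
  then show "E t \<le> exp (M * (t - s)) * E s" by (simp add: right_diff_distrib)
  have "0 \<le> exp (M * t) * E t - exp (M * s) * E s"
  proof (rule has_integral_le_ae[OF has_integral_0 lip_deriv_FTC[OF lip_deriv_mult[OF X E] st] N])
    fix x assume "x \<in> {s..t} - N"
    then have "exp (M * x) * (e x + M * E x) \<ge> 0"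
      using b[of x] st by (intro mult_nonneg_nonneg) auto
    then show "0 \<le> exp (M * x) * M * E x + exp (M * x) * e x" by (simp add: algebra_simps)
  qed
  then have "exp (- M * s) * (exp (M * s) * E s) \<le> exp (- M * s) * (exp (M * t) * E t)"
    by (intro mult_left_mono) auto
  then have "exp (- M * s + M * s) * E s \<le> exp (- M * s + M * t) * E t"
    by (simp only: mult.assoc[symmetric] mult_exp_exp)
  then show "E s \<le> exp (M * (t - s)) * E t" by (simp add: right_diff_distrib)
qed

text \<open>The fundamental theorem of calculus on \<open>[s, t]\<close> bounds the increment of \<open>F\<close> by \<open>B * (t - s)\<close>.\<close>

lemma abs_continuous_imp_lip_deriv:
  assumes ac: "abs_continuous_on_interval 0 T F" and N: "negligible N"
    and der: "\<And>x. x \<in> {0..T} - N \<Longrightarrow> (F has_real_derivative g x) (at x within {0..T})"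
    and bd: "\<And>x. x \<in> {0..T} - N \<Longrightarrow> \<bar>g x\<bar> \<le> B" and B: "B \<ge> 0"
  shows "lip_deriv T F g"
proof -
  have *: "\<bar>F t - F s\<bar> \<le> B * (t - s)" if "0 \<le> s" "s \<le> t" "t \<le> T" for s t
  proof -
    have sub: "{s..t} \<subseteq> {0..T}" using that by auto
    have "(g has_integral (F t - F s)) {s..t}"
    proof (rule abs_continuous_FTC[OF abs_continuous_on_subinterval[OF ac] _ N])
      show "(F has_real_derivative g x) (at x within {s..t})" if "x \<in> {s..t} - N" for x
        using der[of x] that sub by (auto intro: DERIV_subset)
    qed (use that in auto)
    then have "((\<lambda>x. if x \<in> N then 0 else g x) has_integral (F t - F s)) {s..t}"
      by (rule has_integral_spike[OF N, rotated]) auto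
    then have "norm (F t - F s) \<le> B * measure lborel (cbox s t)"
      by (intro has_integral_bound[OF B]) (use bd B sub in \<open>auto simp: subset_iff\<close>)
    then show ?thesis using that by simp
  qed
  have "B-lipschitz_on {0..T} F"
    by (rule lipschitz_on_leI) (use * B in \<open>auto simp: dist_real_def abs_minus_commute\<close>)
  then show ?thesis using N der by (rule lip_derivI)
qed

section \<open>Differentiation and absolute continuity of the Lebesgue integral\<close>

text \<open>The one-sided Lebesgue differentiation theorem, multiplied by \<open>h\<close> to give the first-order
  approximation of the increments of the integral.\<close>

lemma right_derivative_integral_ae:
  fixes g :: "real \<Rightarrow> real"
  assumes g: "\<And>a b. g integrable_on {a..b}"
  obtains N where "negligible N"
    "\<And>x e. x \<notin> N \<Longrightarrow> e > 0 \<Longrightarrow> \<exists>d>0. \<forall>h. 0 < h \<and> h < d \<longrightarrow> \<bar>integral {x..x+h} g - g x * h\<bar> \<le> e * h"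
proof -
  have "g integrable_on cbox a b" for a b using g by simp
  then obtain N where N: "negligible N" and l:
       "\<And>x e. \<lbrakk>x \<notin> N; 0 < e\<rbrakk> \<Longrightarrow> \<exists>d>0. \<forall>h. 0 < h \<and> h < d \<longrightarrow>
          norm (integral (cbox x (x + h *\<^sub>R One)) g /\<^sub>R h ^ DIM(real) - g x) < e"
    using integrable_ccontinuous_explicit[of g] by blast
  show thesis
  proof (rule that[OF N])
    fix x e :: real assume x: "x \<notin> N" and e: "e > 0"
    from l[OF this] obtain d where d: "d > 0" and
      b: "\<forall>h. 0 < h \<and> h < d \<longrightarrow> norm (integral (cbox x (x + h *\<^sub>R One)) g /\<^sub>R h ^ DIM(real) - g x) < e"
      by blast
    show "\<exists>d>0. \<forall>h. 0 < h \<and> h < d \<longrightarrow> \<bar>integral {x..x+h} g - g x * h\<bar> \<le> e * h"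
    proof (intro exI[of _ d] conjI d allI impI, elim conjE)
      fix h :: real assume h: "0 < h" "h < d"
      then have "\<bar>integral {x..x+h} g / h - g x\<bar> < e"
        using b[THEN spec[of _ h]] by (simp add: divide_inverse mult.commute)
      then have "h * \<bar>integral {x..x+h} g / h - g x\<bar> \<le> h * e" using h by (intro mult_left_mono) auto
      moreover have "h * \<bar>integral {x..x+h} g / h - g x\<bar> = \<bar>h * (integral {x..x+h} g / h - g x)\<bar>"
        using h by (simp add: abs_mult)
      moreover have "h * (integral {x..x+h} g / h - g x) = integral {x..x+h} g - g x * h"
        using h by (simp add: field_simps)
      ultimately show "\<bar>integral {x..x+h} g - g x * h\<bar> \<le> e * h" by (simp add: mult.commute)
    qed
  qed
qed

text \<open>The right derivative of the reflected function at \<open>-x\<close> is the left derivative at \<open>x\<close>. Outside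
  of \<open>[0, T]\<close> the function is extended by zero.\<close>

lemma lebesgue_differentiation:
  fixes g :: "real \<Rightarrow> real"
  assumes g: "g absolutely_integrable_on {0..T}"
  obtains N where "negligible N"
    "\<And>x. x \<in> {0..T} - N \<Longrightarrow> ((\<lambda>x. integral {0..x} g) has_real_derivative g x) (at x within {0..T})"
proof -
  define G where "G x = (if x \<in> {0..T} then g x else 0)" for x
  have "G absolutely_integrable_on UNIV"
    using g absolutely_integrable_restrict_UNIV[of "{0..T}" g] unfolding G_def by blast
  then have G: "G integrable_on {a..b}" for a b
    by (metis absolutely_integrable_on_subinterval set_lebesgue_integral_eq_integral(1) subset_UNIV)
  have G': "(\<lambda>x. G (- x)) integrable_on {a..b}" for a b
    using G[of "-b" "-a"] Henstock_Kurzweil_Integration.integrable_reflect_real[where f=G and a="-b" and b="-a"] by simp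
  obtain N where N: "negligible N" and r:
    "\<And>x e. x \<notin> N \<Longrightarrow> e > 0 \<Longrightarrow> \<exists>d>0. \<forall>h. 0 < h \<and> h < d \<longrightarrow> \<bar>integral {x..x+h} G - G x * h\<bar> \<le> e * h"
    by (rule right_derivative_integral_ae[OF G]) blast
  obtain N' where N': "negligible N'" and l:
    "\<And>x e. x \<notin> N' \<Longrightarrow> e > 0 \<Longrightarrow> \<exists>d>0. \<forall>h. 0 < h \<and> h < d \<longrightarrow>
      \<bar>integral {x..x+h} (\<lambda>x. G (-x)) - G (-x) * h\<bar> \<le> e * h"
    by (rule right_derivative_integral_ae[OF G']) blast
  have neg: "negligible (uminus ` N')"
    using N' by (intro negligible_differentiable_image_negligible) (auto intro!: derivative_intros)
  have gi: "g integrable_on {s..t}" if "0 \<le> s" "t \<le> T" for s t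
    using that g by (intro integrable_subinterval_real[OF set_lebesgue_integral_eq_integral(1)[OF g]]) auto
  have eq: "integral {s..t} G = integral {s..t} g" if "0 \<le> s" "t \<le> T" for s t
    using that by (intro integral_cong) (auto simp: G_def)
  show thesis
  proof (rule that[of "N \<union> uminus ` N'"])
    show "negligible (N \<union> uminus ` N')" using N neg by simp
    fix x assume x: "x \<in> {0..T} - (N \<union> uminus ` N')"
    then have xN: "x \<notin> N" "- x \<notin> N'" and x0: "0 \<le> x" "x \<le> T" by (auto simp: image_iff)
    show "((\<lambda>x. integral {0..x} g) has_real_derivative g x) (at x within {0..T})"
      unfolding has_field_derivative_def has_derivative_within_alt
    proof (intro conjI allI impI bounded_linear_mult_right)
      fix e :: real assume e: "e > 0"
      obtain d where d: "d > 0" "\<And>h. 0 < h \<Longrightarrow> h < d \<Longrightarrow> \<bar>integral {x..x+h} G - G x * h\<bar> \<le> e * h"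
        using r[OF xN(1) e] by blast
      obtain d' where d': "d' > 0" "\<And>h. 0 < h \<Longrightarrow> h < d' \<Longrightarrow> \<bar>integral {-x..-x+h} (\<lambda>x. G (-x)) - G (-(-x)) * h\<bar> \<le> e * h"
        using l[OF xN(2) e] by blast
      show "\<exists>d>0. \<forall>y\<in>{0..T}. norm (y - x) < d \<longrightarrow>
          norm (integral {0..y} g - integral {0..x} g - g x * (y - x)) \<le> e * norm (y - x)"
      proof (intro exI[of _ "min d d'"] conjI ballI impI)
        fix y assume y: "y \<in> {0..T}" "norm (y - x) < min d d'"
        consider "y = x" | "y > x" | "y < x" by linarith
        then show "norm (integral {0..y} g - integral {0..x} g - g x * (y - x)) \<le> e * norm (y - x)"
        proof cases
          case 2
          have "integral {0..y} g - integral {0..x} g = integral {x..x + (y - x)} G"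
            using Henstock_Kurzweil_Integration.integral_combine[of 0 x y g] gi[of 0 y] eq[of x y] 2 x0 y by simp
          then show ?thesis using d(2)[of "y - x"] 2 y x0 by (simp add: G_def)
        next
          case 3
          have "integral {-x..-x + (x - y)} (\<lambda>x. G (-x)) = integral {y..x} G"
            using Henstock_Kurzweil_Integration.integral_reflect_real[where f=G and a=y and b=x] by simp
          moreover have "integral {0..x} g - integral {0..y} g = integral {y..x} G"
            using Henstock_Kurzweil_Integration.integral_combine[of 0 y x g] gi[of 0 x] eq[of y x] 3 x0 y by simp
          ultimately have "\<bar>integral {0..x} g - integral {0..y} g - g x * (x - y)\<bar> \<le> e * (x - y)"
            using d'(2)[of "x - y"] 3 y x0 by (simp add: G_def)
          moreover have "integral {0..y} g - integral {0..x} g - g x * (y - x) = 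
            - (integral {0..x} g - integral {0..y} g - g x * (x - y))" by (simp add: algebra_simps)
          ultimately show ?thesis using 3 by (metis abs_minus_cancel abs_of_neg diff_less_0_iff_less minus_diff_eq real_norm_def)
        qed simp
      qed (use d d' in simp)
    qed
  qed
qed

text \<open>The part of \<open>g\<close> above a high level has a small integral, by dominated convergence. This is what
  gives the absolute continuity of the indefinite integral of an unbounded function.\<close>

lemma integral_truncation_small:
  fixes g :: "real \<Rightarrow> real"
  assumes g: "g absolutely_integrable_on S" and S: "S \<in> sets lebesgue" and e: "e > 0"
  obtains k :: nat where "(\<lambda>x. max (\<bar>g x\<bar> - real k) 0) integrable_on S"
    "integral S (\<lambda>x. max (\<bar>g x\<bar> - real k) 0) < e"
proof -
  have gm: "g \<in> borel_measurable (lebesgue_on S)"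
    using integrable_imp_measurable[OF set_lebesgue_integral_eq_integral(1)[OF g]] .
  have gi: "(\<lambda>x. \<bar>g x\<bar>) integrable_on S"
    using g by (simp add: absolutely_integrable_on_def)
  have int: "(\<lambda>x. max (\<bar>g x\<bar> - real k) 0) integrable_on S" for k
    by (rule measurable_bounded_by_integrable_imp_integrable_real[OF _ gi _ S]) (use gm in auto)
  have "(\<lambda>k. integral S (\<lambda>x. max (\<bar>g x\<bar> - real k) 0)) \<longlonglongrightarrow> integral S (\<lambda>x. 0)"
  proof (rule dominated_convergence(2)[OF int gi])
    show "(\<lambda>k. max (\<bar>g x\<bar> - real k) 0) \<longlonglongrightarrow> 0" if "x \<in> S" for x
    proof (rule tendsto_eventually)
      show "\<forall>\<^sub>F k in sequentially. max (\<bar>g x\<bar> - real k) 0 = 0"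
        using eventually_ge_at_top[of "nat \<lceil>\<bar>g x\<bar>\<rceil>"] by eventually_elim linarith
    qed
  qed auto
  then have "\<forall>\<^sub>F k in sequentially. integral S (\<lambda>x. max (\<bar>g x\<bar> - real k) 0) < e"
    using e by (simp add: order_tendsto_iff)
  then obtain k where "integral S (\<lambda>x. max (\<bar>g x\<bar> - real k) 0) < e"
    by (auto dest: eventually_happens)
  with int[of k] show thesis by (rule that)
qed

lemma abs_continuous_integral:
  fixes g :: "real \<Rightarrow> real"
  assumes g: "g absolutely_integrable_on {0..T}"
  shows "abs_continuous_on_interval 0 T (\<lambda>x. integral {0..x} g)"
  unfolding abs_continuous_on_interval_def
proof (intro allI impI)
  fix e :: real assume e: "e > 0"
  then have "e / 2 > 0" by simp
  then obtain k :: nat where Hi: "(\<lambda>x. max (\<bar>g x\<bar> - real k) 0) integrable_on {0..T}"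
    and Hs: "integral {0..T} (\<lambda>x. max (\<bar>g x\<bar> - real k) 0) < e / 2"
    using integral_truncation_small[OF g, of "e / 2"] by auto
  define H where "H x = max (\<bar>g x\<bar> - real k) 0" for x
  have gi: "g integrable_on {s..t}" if "0 \<le> s" "t \<le> T" for s t
    using that by (intro integrable_subinterval_real[OF set_lebesgue_integral_eq_integral(1)[OF g]]) auto
  have Hi': "H integrable_on {s..t}" if "0 \<le> s" "t \<le> T" for s t
    using that by (intro integrable_subinterval_real[OF Hi[folded H_def]]) auto
  show "\<exists>\<delta>>0. \<forall>(m::nat) s t.
        (\<forall>i<m. 0 \<le> s i \<and> s i \<le> t i \<and> t i \<le> T) \<longrightarrow>
        (\<forall>i<m. \<forall>j<m. i \<noteq> j \<longrightarrow> {s i<..<t i} \<inter> {s j<..<t j} = {}) \<longrightarrow>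
        (\<Sum>i<m. t i - s i) < \<delta> \<longrightarrow> (\<Sum>i<m. \<bar>integral {0..t i} g - integral {0..s i} g\<bar>) < e"
  proof (intro exI[of _ "e / (2 * (real k + 1))"] conjI allI impI)
    fix m :: nat and s t
    assume 1: "\<forall>i<m. 0 \<le> s i \<and> s i \<le> t i \<and> t i \<le> T"
      and 2: "\<forall>i<m. \<forall>j<m. i \<noteq> j \<longrightarrow> {s i<..<t i} \<inter> {s j<..<t j} = {}"
      and 3: "(\<Sum>i<m. t i - s i) < e / (2 * (real k + 1))"
    have "(\<Sum>i<m. \<bar>integral {0..t i} g - integral {0..s i} g\<bar>)
        \<le> (\<Sum>i<m. integral {s i<..<t i} H + (real k + 1) * (t i - s i))"
    proof (rule sum_mono)
      fix i assume "i \<in> {..<m}"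
      then have i: "0 \<le> s i" "s i \<le> t i" "t i \<le> T" using 1 by auto
      have pt: "\<bar>g x\<bar> \<le> H x + (real k + 1)" for x by (simp add: H_def)
      have "\<bar>integral {0..t i} g - integral {0..s i} g\<bar> = norm (integral {s i..t i} g)"
        using Henstock_Kurzweil_Integration.integral_combine[of 0 "s i" "t i" g] gi[of 0 "t i"] i by simp
      also have "\<dots> \<le> integral {s i..t i} (\<lambda>x. H x + (real k + 1))"
        by (rule integral_norm_bound_integral) (use gi Hi' i in \<open>auto intro!: integrable_add simp: pt\<close>)
      also have "\<dots> = integral {s i..t i} H + (real k + 1) * (t i - s i)"
        using i Hi' by (subst Henstock_Kurzweil_Integration.integral_add) auto
      finally show "\<bar>integral {0..t i} g - integral {0..s i} g\<bar> \<le> integral {s i<..<t i} H + (real k + 1) * (t i - s i)"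
        by (simp add: integral_open_interval_real)
    qed
    also have "\<dots> = (\<Sum>i<m. integral {s i<..<t i} H) + (real k + 1) * (\<Sum>i<m. t i - s i)"
      by (simp add: sum.distrib sum_distrib_left)
    also have "\<dots> < e / 2 + (real k + 1) * (e / (2 * (real k + 1)))"
    proof (rule add_le_less_mono)
      have hi: "(H has_integral integral {s i<..<t i} H) {s i<..<t i}" if "i < m" for i
        using 1 that Hi' integrable_on_open_interval_real by blast
      have "(H has_integral (\<Sum>i\<in>{..<m}. integral {s i<..<t i} H)) (\<Union>i\<in>{..<m}. {s i<..<t i})"
        by (rule has_integral_UN) (use hi 2 in \<open>auto simp: pairwise_def\<close>)
      then have "(\<Sum>i\<in>{..<m}. integral {s i<..<t i} H) \<le> integral {0..T} H"
        by (rule has_integral_subset_le[rotated, OF _ integrable_integral[OF Hi[folded H_def]]])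
          (use 1 in \<open>force simp: H_def\<close>)+
      then show "(\<Sum>i<m. integral {s i<..<t i} H) \<le> e / 2" using Hs[folded H_def] by linarith
      show "(real k + 1) * (\<Sum>i<m. t i - s i) < (real k + 1) * (e / (2 * (real k + 1)))"
        using 3 by (intro mult_strict_left_mono) auto
    qed
    also have "\<dots> = e" by (simp add: field_simps)
    finally show "(\<Sum>i<m. \<bar>integral {0..t i} g - integral {0..s i} g\<bar>) < e" .
  qed (use e in auto)
qed

text \<open>The argument \<open>u\<close> is rounded down to the grid of mesh \<open>1 / (k + 1)\<close>. With a countable range it can
  be substituted into a function that is measurable for each fixed argument, and continuity of \<open>f x\<close>
  gives the limit.\<close>

lemma caratheodory_measurable:
  fixes f :: "real \<Rightarrow> real \<Rightarrow> real"
  assumes f: "\<And>u. (\<lambda>x. f x u) \<in> borel_measurable lebesgue"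
    and cont: "\<And>x. continuous_on UNIV (f x)" and u: "u \<in> borel_measurable lebesgue"
  shows "(\<lambda>x. f x (u x)) \<in> borel_measurable lebesgue"
proof (rule borel_measurable_LIMSEQ_real)
  define r where "r k y = real_of_int \<lfloor>real (Suc k) * y\<rfloor> / real (Suc k)" for k y
  show "(\<lambda>x. f x (r k (u x))) \<in> borel_measurable lebesgue" for k
  proof -
    have "(\<lambda>x. \<lfloor>real (Suc k) * u x\<rfloor>) \<in> measurable lebesgue (count_space UNIV)"
      using u by measurable
    from measurable_compose_countable[OF f this, of "\<lambda>j. real_of_int j / real (Suc k)"]
    have "(\<lambda>x. f x (real_of_int \<lfloor>real (Suc k) * u x\<rfloor> / real (Suc k))) \<in> borel_measurable lebesgue" .
    then show ?thesis by (simp add: r_def)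
  qed
  fix x
  have "(\<lambda>k. r k (u x)) \<longlonglongrightarrow> u x"
  proof (rule tendsto_sandwich)
    show "\<forall>\<^sub>F k in sequentially. u x - inverse (real (Suc k)) \<le> r k (u x)"
    proof (intro always_eventually allI)
      fix k
      have "(real (Suc k) * u x - 1) / real (Suc k) \<le> r k (u x)"
        unfolding r_def by (intro divide_right_mono) linarith+
      then show "u x - inverse (real (Suc k)) \<le> r k (u x)"
        by (simp add: diff_divide_distrib inverse_eq_divide del: of_nat_Suc)
    qed
    show "\<forall>\<^sub>F k in sequentially. r k (u x) \<le> u x"
    proof (intro always_eventually allI)
      fix k
      have "r k (u x) \<le> (real (Suc k) * u x) / real (Suc k)"
        unfolding r_def by (intro divide_right_mono) linarith+
      then show "r k (u x) \<le> u x" by (simp del: of_nat_Suc)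
    qed
    show "(\<lambda>k. u x - inverse (real (Suc k))) \<longlonglongrightarrow> u x"
      using tendsto_diff[OF tendsto_const LIMSEQ_inverse_real_of_nat, of "u x"] by simp
  qed auto
  moreover have "isCont (f x) (u x)" using cont[of x] by (simp add: continuous_on_eq_continuous_at)
  ultimately show "(\<lambda>k. f x (r k (u x))) \<longlonglongrightarrow> f x (u x)" by (rule isCont_tendsto_compose[rotated])
qed

section \<open>Initial value problems\<close>

text \<open>The derivative is a parameter because the initial slope \<open>u' 0\<close> is one of the two coordinates of
  the phase plane.\<close>

definition ode_solution ::
    "real \<Rightarrow> (real \<Rightarrow> real \<Rightarrow> real) \<Rightarrow> (real \<Rightarrow> real) \<Rightarrow> (real \<Rightarrow> real) \<Rightarrow> bool" where
  "ode_solution T f u u' \<longleftrightarrow>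
     (\<forall>x\<in>{0..T}. (u has_real_derivative u' x) (at x within {0..T})) \<and>
     continuous_on {0..T} u' \<and> abs_continuous_on_interval 0 T u' \<and>
     (AE x in lebesgue_on {0<..<T}. \<exists>w. (u' has_real_derivative w) (at x) \<and> w + f x (u x) = 0)"

lemma periodic_solution_iff:
  "periodic_solution T f u \<longleftrightarrow> (\<exists>u'. ode_solution T f u u' \<and> u 0 = u T \<and> u' 0 = u' T)"
  unfolding periodic_solution_def ode_solution_def by (simp add: conj_assoc)

text \<open>Adding the end points to the exceptional set turns statements on the open interval into
  statements on the closed one. At a point of \<open>[0, T]\<close> outside of such a set the one-sided and
  the two-sided derivatives agree.\<close>

lemma AE_open_interval_iff_negligible:
  fixes P :: "real \<Rightarrow> bool"
  shows "(AE x in lebesgue_on {0<..<T}. P x) \<longleftrightarrow>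
    (\<exists>N. negligible N \<and> 0 \<in> N \<and> T \<in> N \<and> (\<forall>x\<in>{0..T} - N. P x))"
proof
  assume "AE x in lebesgue_on {0<..<T}. P x"
  then have "AE x in lebesgue. x \<in> {0<..<T} \<longrightarrow> P x"
    using AE_restrict_space_iff[of "{0<..<T}" lebesgue P] by simp
  then obtain N where N: "N \<in> null_sets lebesgue"
    and P: "\<And>x. x \<in> space lebesgue - N \<Longrightarrow> x \<in> {0<..<T} \<longrightarrow> P x"
    by (rule AE_E3) blast
  have "P x" if "x \<in> {0..T} - insert 0 (insert T N)" for x
    using P[of x] that by simp
  moreover have "negligible (insert 0 (insert T N))" using N by (simp add: negligible_iff_null_sets[symmetric])
  ultimately show "\<exists>N. negligible N \<and> 0 \<in> N \<and> T \<in> N \<and> (\<forall>x\<in>{0..T} - N. P x)"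
    by (intro exI[of _ "insert 0 (insert T N)"]) simp
next
  assume "\<exists>N. negligible N \<and> 0 \<in> N \<and> T \<in> N \<and> (\<forall>x\<in>{0..T} - N. P x)"
  then obtain N where N: "negligible N" "\<forall>x\<in>{0..T} - N. P x" by (elim exE conjE)
  then have "AE x in lebesgue. x \<notin> N" by (simp add: AE_not_in negligible_iff_null_sets)
  then have "AE x in lebesgue. x \<in> {0<..<T} \<longrightarrow> P x"
  proof eventually_elim
    case (elim x)
    then show ?case using N(2)[THEN bspec, of x] by simp
  qed
  then show "AE x in lebesgue_on {0<..<T}. P x"
    using AE_restrict_space_iff[of "{0<..<T}" lebesgue P] by simp
qed

lemma AE_open_intervalE:
  fixes P :: "real \<Rightarrow> bool"
  assumes "AE x in lebesgue_on {0<..<T}. P x"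
  obtains N where "negligible N" "0 \<in> N" "T \<in> N" "\<And>x. x \<in> {0..T} - N \<Longrightarrow> P x"
proof -
  from AE_open_interval_iff_negligible[THEN iffD1, OF assms]
  obtain N where N: "negligible N" "0 \<in> N" "T \<in> N" "\<forall>x\<in>{0..T} - N. P x" by (elim exE conjE)
  show thesis by (rule that[OF N(1-3)]) (rule N(4)[THEN bspec])
qed

text \<open>The values \<open>f x (u x)\<close> are dominated by \<open>\<bar>f x 0\<bar> + \<bar>K\<bar> * \<bar>u x\<bar>\<close>; measurability is the point, and
  needs \<open>u\<close> to be extended to the whole line, which is done by constants.\<close>

lemma nemytskii_integrable:
  fixes f :: "real \<Rightarrow> real \<Rightarrow> real"
  assumes meas: "\<And>u. (\<lambda>x. f x u) \<in> borel_measurable lebesgue"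
    and cont: "\<And>x. continuous_on UNIV (f x)"
    and N: "negligible N"
    and lip: "\<And>x u v. x \<in> {0..T} - N \<Longrightarrow> \<bar>f x u - f x v\<bar> \<le> K * \<bar>u - v\<bar>"
    and f0: "(\<lambda>x. f x 0) absolutely_integrable_on {0..T}"
    and u: "continuous_on {0..T} u"
  shows "(\<lambda>x. f x (u x)) absolutely_integrable_on {0..T}"
proof (cases "T \<ge> 0")
  case T: True
  define U where "U x = u (max 0 (min T x))" for x
  have "continuous_on UNIV U"
    unfolding U_def by (rule continuous_on_compose2[OF u]) (use T in \<open>auto intro!: continuous_intros\<close>)
  then have "U \<in> borel_measurable borel" by (rule borel_measurable_continuous_onI)
  then have "U \<in> borel_measurable lebesgue" by (simp add: measurable_completion)
  from caratheodory_measurable[OF meas cont this]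
  have m: "(\<lambda>x. f x (U x)) \<in> borel_measurable (lebesgue_on {0..T})"
    by (rule measurable_restrict_space1)
  have int: "integrable (lebesgue_on {0..T}) (\<lambda>x. \<bar>f x 0\<bar> + \<bar>K\<bar> * \<bar>U x\<bar>)"
  proof (intro Bochner_Integration.integrable_add integrable_abs integrable_mult_right)
    show "integrable (lebesgue_on {0..T}) (\<lambda>x. f x 0)"
      using absolutely_integrable_imp_integrable[OF f0] by simp
    have "U absolutely_integrable_on {0..T}"
      by (intro absolutely_integrable_continuous_real continuous_on_subset[OF \<open>continuous_on UNIV U\<close>]) simp
    from absolutely_integrable_imp_integrable[OF this]
    show "integrable (lebesgue_on {0..T}) U" by simp
  qed
  have "integrable (lebesgue_on {0..T}) (\<lambda>x. f x (U x))"
  proof (rule Bochner_Integration.integrable_bound[OF int m])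
    have "AE x in lebesgue. x \<notin> N" using N by (simp add: AE_not_in negligible_iff_null_sets)
    then have "AE x in lebesgue. x \<in> {0..T} \<longrightarrow> norm (f x (U x)) \<le> norm (\<bar>f x 0\<bar> + \<bar>K\<bar> * \<bar>U x\<bar>)"
    proof eventually_elim
      case (elim x)
      show ?case
      proof
        assume "x \<in> {0..T}"
        then have "\<bar>f x (U x) - f x 0\<bar> \<le> K * \<bar>U x\<bar>" using lip[of x "U x" 0] elim by simp
        also have "\<dots> \<le> \<bar>K\<bar> * \<bar>U x\<bar>" by (intro mult_right_mono) auto
        finally have "\<bar>f x (U x)\<bar> \<le> \<bar>f x 0\<bar> + \<bar>K\<bar> * \<bar>U x\<bar>" by linarith
        then show "norm (f x (U x)) \<le> norm (\<bar>f x 0\<bar> + \<bar>K\<bar> * \<bar>U x\<bar>)" by simp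
      qed
    qed
    then show "AE x in lebesgue_on {0..T}. norm (f x (U x)) \<le> norm (\<bar>f x 0\<bar> + \<bar>K\<bar> * \<bar>U x\<bar>)"
      using AE_restrict_space_iff[of "{0..T}" lebesgue "\<lambda>x. norm (f x (U x)) \<le> norm (\<bar>f x 0\<bar> + \<bar>K\<bar> * \<bar>U x\<bar>)"] by simp
  qed
  then have "(\<lambda>x. f x (U x)) absolutely_integrable_on {0..T}"
    by (simp add: set_integrable_def integrable_restrict_space)
  moreover have "(\<lambda>x. f x (U x)) absolutely_integrable_on {0..T} \<longleftrightarrow> (\<lambda>x. f x (u x)) absolutely_integrable_on {0..T}"
    by (rule set_integrable_cong) (auto simp: U_def)
  ultimately show ?thesis by simp
qed (simp add: set_integrable_def)

text \<open>Integration gains the factor \<open>1 / M\<close> for functions bounded by multiples of \<open>exp (M s)\<close>. Hence an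
  integral operator with a Lipschitz kernel is a contraction in the norm weighted by
  \<open>exp (- M s)\<close> on the whole interval if \<open>M\<close> is large.\<close>

lemma exp_weighted_integral_bound:
  fixes g :: "real \<Rightarrow> real"
  assumes g: "g integrable_on {0..t}" and N: "negligible N" and t: "t \<ge> 0" and M: "M > 0" and A: "A \<ge> 0"
    and b: "\<And>s. s \<in> {0..t} - N \<Longrightarrow> \<bar>g s\<bar> \<le> A * exp (M * s)"
  shows "\<bar>integral {0..t} g\<bar> \<le> A / M * exp (M * t)"
proof -
  have E: "((\<lambda>s. A * exp (M * s)) has_integral (A / M * exp (M * t) - A / M * exp (M * 0))) {0..t}"
  proof (rule fundamental_theorem_of_calculus[OF t])
    fix x
    have "((\<lambda>s. A / M * exp (M * s)) has_real_derivative A / M * (exp (M * x) * M)) (at x within {0..t})"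
      by (rule derivative_eq_intros refl | simp)+
    then show "((\<lambda>s. A / M * exp (M * s)) has_vector_derivative A * exp (M * x)) (at x within {0..t})"
      using M by (simp add: has_real_derivative_iff_has_vector_derivative)
  qed
  have E': "((\<lambda>s. - (A * exp (M * s))) has_integral - (A / M * exp (M * t) - A / M * exp (M * 0))) {0..t}"
    by (rule has_integral_neg[OF E])
  have "integral {0..t} g \<le> A / M * exp (M * t) - A / M * exp (M * 0)"
  proof (rule has_integral_le_ae[OF integrable_integral[OF g] E N])
    show "g x \<le> A * exp (M * x)" if "x \<in> {0..t} - N" for x using b[OF that] by linarith
  qed
  moreover have "- (A / M * exp (M * t) - A / M * exp (M * 0)) \<le> integral {0..t} g"
  proof (rule has_integral_le_ae[OF E' integrable_integral[OF g] N])
    show "- (A * exp (M * x)) \<le> g x" if "x \<in> {0..t} - N" for x using b[OF that] by linarith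
  qed
  moreover have "A / M \<ge> 0" using A M by simp
  ultimately show ?thesis by simp
qed

text \<open>Banach's fixed point theorem for the twice integrated equation. The unknown is
  \<open>\<phi> x = exp (- M x) * u x\<close>, extended by constants beyond \<open>[0, T]\<close>, so that the usual supremum
  distance on bounded continuous functions is the exponentially weighted distance of \<open>u\<close>. By
  \<open>exp_weighted_integral_bound\<close>, applied to both integrations, the contraction factor is
  \<open>K / M\<^sup>2\<close>.\<close>

lemma ivp_solvable:
  fixes f :: "real \<Rightarrow> real \<Rightarrow> real"
  assumes T: "T \<ge> 0"
    and meas: "\<And>u. (\<lambda>x. f x u) \<in> borel_measurable lebesgue"
    and cont: "\<And>x. continuous_on UNIV (f x)"
    and N: "negligible N" and K: "K \<ge> 0"
    and lip: "\<And>x u v. x \<in> {0..T} - N \<Longrightarrow> \<bar>f x u - f x v\<bar> \<le> K * \<bar>u - v\<bar>"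
    and f0: "(\<lambda>x. f x 0) absolutely_integrable_on {0..T}"
  obtains u u' where "ode_solution T f u u'" "u 0 = p" "u' 0 = q"
proof -
  \<comment> \<open>Any \<open>M\<close> with \<open>K < M\<^sup>2\<close> makes the operator contract.\<close>
  define M where "M = K + 1"
  have M: "M > 0" using K by (simp add: M_def)
  \<comment> \<open>The retraction onto \<open>[0, T]\<close>.\<close>
  define c where "c x = max 0 (min T x)" for x
  have c: "c x \<in> {0..T}" for x using T by (auto simp: c_def)
  have c_id: "c x = x" if "x \<in> {0..T}" for x using that by (auto simp: c_def)
  have c_cont: "continuous_on UNIV c" unfolding c_def by (intro continuous_intros)
  define F :: "(real \<Rightarrow>\<^sub>C real) \<Rightarrow> real \<Rightarrow> real" where "F \<phi> s = f s (exp (M * s) * \<phi> s)" for \<phi> s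
  \<comment> \<open>\<open>J \<phi>\<close> is the twice integrated equation with the initial data \<open>p\<close> and \<open>q\<close>, and \<open>I \<phi>\<close> is the decrease
    of the slope.\<close>
  define I where "I \<phi> t = integral {0..t} (F \<phi>)" for \<phi> t
  define J where "J \<phi> x = p + q * x - integral {0..x} (I \<phi>)" for \<phi> x
  define B where "B \<phi> x = exp (- (M * c x)) * J \<phi> (c x)" for \<phi> x
  have F_abs: "F \<phi> absolutely_integrable_on {0..T}" for \<phi>
    unfolding F_def by (rule nemytskii_integrable[OF meas cont N lip f0]) (auto intro!: continuous_intros)
  have F_int: "F \<phi> integrable_on {0..t}" if "t \<in> {0..T}" for \<phi> t
    using integrable_subinterval_real[OF set_lebesgue_integral_eq_integral(1)[OF F_abs]] that by auto
  have I_cont: "continuous_on {0..T} (I \<phi>)" for \<phi>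
    unfolding I_def using F_int[of T] T by (intro indefinite_integral_continuous_1) auto
  have I_int: "I \<phi> integrable_on {0..t}" if "t \<in> {0..T}" for \<phi> t
    using that by (intro integrable_continuous_real continuous_on_subset[OF I_cont]) auto
  have J_cont: "continuous_on {0..T} (J \<phi>)" for \<phi>
    unfolding J_def using I_int[of T] T
    by (intro continuous_intros indefinite_integral_continuous_1) auto
  have B_cont: "continuous_on UNIV (B \<phi>)" for \<phi>
    unfolding B_def
    by (intro continuous_intros c_cont continuous_on_compose2[OF J_cont c_cont]) (use c in auto)
  have B_bcont: "B \<phi> \<in> bcontfun" for \<phi>
  proof -
    have "range (B \<phi>) \<subseteq> B \<phi> ` {0..T}"
    proof
      fix y assume "y \<in> range (B \<phi>)"
      then obtain x where "y = B \<phi> x" by blast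
      then have "y = B \<phi> (c x)" using c[of x] c_id[of "c x"] by (simp add: B_def)
      then show "y \<in> B \<phi> ` {0..T}" using c by blast
    qed
    moreover have "bounded (B \<phi> ` {0..T})"
      using B_cont by (meson compact_Icc compact_continuous_image compact_imp_bounded continuous_on_subset subset_UNIV)
    ultimately show ?thesis using B_cont bounded_subset by (auto simp: bcontfun_def)
  qed
  have "\<exists>!\<phi>. Bcontfun (B \<phi>) = \<phi>"
  proof (rule banach_fix_type[of "K / M / M"])
    show "0 \<le> K / M / M" using K M by simp
    have "K < M * M" using K mult_nonneg_nonneg[OF K K] unfolding M_def distrib_left distrib_right by linarith
    then show "K / M / M < 1" using M by (simp add: field_simps)
    show "\<forall>\<phi> \<psi>. dist (Bcontfun (B \<phi>)) (Bcontfun (B \<psi>)) \<le> K / M / M * dist \<phi> \<psi>"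
    proof (intro allI)
      fix \<phi> \<psi> :: "real \<Rightarrow>\<^sub>C real"
      define D where "D = dist \<phi> \<psi>"
      have D0: "D \<ge> 0" by (simp add: D_def)
      have bF: "\<bar>F \<phi> s - F \<psi> s\<bar> \<le> (K * D) * exp (M * s)" if "s \<in> {0..T} - N" for s
      proof -
        have "\<bar>F \<phi> s - F \<psi> s\<bar> \<le> K * \<bar>exp (M * s) * \<phi> s - exp (M * s) * \<psi> s\<bar>"
          unfolding F_def by (rule lip[OF that])
        also have "\<bar>exp (M * s) * \<phi> s - exp (M * s) * \<psi> s\<bar> = exp (M * s) * \<bar>\<phi> s - \<psi> s\<bar>"
          by (simp add: right_diff_distrib[symmetric] abs_mult)
        also have "K * (exp (M * s) * \<bar>\<phi> s - \<psi> s\<bar>) \<le> K * (exp (M * s) * D)"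
          using dist_bounded[of \<phi> s \<psi>] K by (intro mult_left_mono) (auto simp: D_def dist_real_def)
        finally show ?thesis by (simp add: algebra_simps)
      qed
      have bI: "\<bar>I \<phi> t - I \<psi> t\<bar> \<le> (K * D / M) * exp (M * t)" if "t \<in> {0..T}" for t
      proof -
        have "I \<phi> t - I \<psi> t = integral {0..t} (\<lambda>s. F \<phi> s - F \<psi> s)"
          unfolding I_def using F_int that by (simp add: Henstock_Kurzweil_Integration.integral_diff)
        also have "\<bar>\<dots>\<bar> \<le> (K * D / M) * exp (M * t)"
          by (rule exp_weighted_integral_bound[OF _ N _ M]) (use that F_int K D0 bF in \<open>auto intro!: integrable_diff\<close>)
        finally show ?thesis .
      qed
      have bJ: "\<bar>J \<phi> x - J \<psi> x\<bar> \<le> (K * D / M / M) * exp (M * x)" if "x \<in> {0..T}" for x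
      proof -
        have "J \<phi> x - J \<psi> x = - integral {0..x} (\<lambda>s. I \<phi> s - I \<psi> s)"
          unfolding J_def using I_int that by (simp add: Henstock_Kurzweil_Integration.integral_diff)
        also have "\<bar>\<dots>\<bar> \<le> (K * D / M / M) * exp (M * x)"
          unfolding abs_minus_cancel
          by (rule exp_weighted_integral_bound[OF _ negligible_empty _ M])
            (use that I_int K D0 M bI in \<open>auto intro!: integrable_diff\<close>)
        finally show ?thesis .
      qed
      show "dist (Bcontfun (B \<phi>)) (Bcontfun (B \<psi>)) \<le> K / M / M * dist \<phi> \<psi>"
      proof (rule dist_bound)
        fix x
        have "\<bar>B \<phi> x - B \<psi> x\<bar> = exp (- (M * c x)) * \<bar>J \<phi> (c x) - J \<psi> (c x)\<bar>"
          by (simp add: B_def right_diff_distrib[symmetric] abs_mult)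
        also have "\<dots> \<le> exp (- (M * c x)) * ((K * D / M / M) * exp (M * c x))"
          by (intro mult_left_mono bJ c) auto
        also have "\<dots> = K / M / M * D" by (simp add: exp_minus)
        finally show "dist (Bcontfun (B \<phi>) x) (Bcontfun (B \<psi>) x) \<le> K / M / M * dist \<phi> \<psi>"
          by (simp add: Bcontfun_inverse[OF B_bcont] dist_real_def D_def)
      qed
    qed
  qed
  then obtain \<phi> where "Bcontfun (B \<phi>) = \<phi>" by blast
  then have fix_eq: "apply_bcontfun \<phi> = B \<phi>" using Bcontfun_inverse[OF B_bcont[of \<phi>]] by simp
  define u where "u = J \<phi>"
  define u' where "u' x = q - I \<phi> x" for x
  have exp_cancel: "exp (M * s) * (exp (- (M * s)) * y) = y" for s y :: real
    by (simp add: mult.assoc[symmetric] mult_exp_exp)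
  have F_eq: "F \<phi> s = f s (u s)" if "s \<in> {0..T}" for s
    using c_id[OF that] by (simp add: F_def fix_eq B_def u_def exp_cancel)
  have "ode_solution T f u u'"
    unfolding ode_solution_def
  proof (intro conjI ballI)
    fix x assume x: "x \<in> {0..T}"
    have "((\<lambda>x. integral {0..x} (I \<phi>)) has_real_derivative I \<phi> x) (at x within {0..T})"
      using integral_has_real_derivative[OF I_cont x] .
    then show "(u has_real_derivative u' x) (at x within {0..T})"
      unfolding u_def u'_def J_def by (auto intro!: derivative_eq_intros)
  next
    show "continuous_on {0..T} u'" unfolding u'_def by (intro continuous_intros I_cont)
    show "abs_continuous_on_interval 0 T u'"
      unfolding u'_def I_def
      by (intro abs_continuous_on_diff abs_continuous_integral F_abs)
        (rule lipschitz_imp_abs_continuous[OF lipschitz_on_constant])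
    obtain N' where N': "negligible N'" and
      d: "\<And>x. x \<in> {0..T} - N' \<Longrightarrow> ((\<lambda>x. integral {0..x} (F \<phi>)) has_real_derivative F \<phi> x) (at x within {0..T})"
      by (rule lebesgue_differentiation[OF F_abs]) blast
    have "\<exists>w. (u' has_real_derivative w) (at x) \<and> w + f x (u x) = 0"
      if "x \<in> {0..T} - (insert 0 (insert T N'))" for x
    proof -
      have "at x within {0..T} = at x" using that by (intro at_within_Icc_at) auto
      then have "(I \<phi> has_real_derivative F \<phi> x) (at x)" using d[of x] that by (simp add: I_def[abs_def])
      then have "(u' has_real_derivative - F \<phi> x) (at x)"
        unfolding u'_def by (auto intro!: derivative_eq_intros)
      then show ?thesis using F_eq[of x] that by auto
    qed
    then show "AE x in lebesgue_on {0<..<T}. \<exists>w. (u' has_real_derivative w) (at x) \<and> w + f x (u x) = 0"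
      unfolding AE_open_interval_iff_negligible using N'
      by (intro exI[of _ "insert 0 (insert T N')"]) auto
  qed
  moreover have "u 0 = p" "u' 0 = q" by (simp_all add: u_def u'_def J_def I_def)
  ultimately show thesis by (rule that)
qed

section \<open>Differences of solutions in the phase plane\<close>

text \<open>Subtracting the equations gives \<open>\<bar>w''\<bar> \<le> K * \<bar>w\<bar>\<close> almost everywhere, so \<open>w'\<close> is Lipschitz even
  though \<open>u'\<close> and \<open>v'\<close> are only absolutely continuous. The function \<open>d\<close> is set to zero on the
  exceptional set, so that its bound holds everywhere.\<close>

lemma ode_difference:
  assumes N: "negligible N" and K: "K \<ge> 0"
    and lip: "\<And>x u v. x \<in> {0..T} - N \<Longrightarrow> \<bar>f x u - f x v\<bar> \<le> K * \<bar>u - v\<bar>"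
    and u: "ode_solution T f u u'" and v: "ode_solution T f v v'"
  obtains d N' where "negligible N'" "N \<subseteq> N'"
    "lip_deriv T (\<lambda>x. u x - v x) (\<lambda>x. u' x - v' x)" "lip_deriv T (\<lambda>x. u' x - v' x) d"
    "\<And>x. x \<in> {0..T} \<Longrightarrow> \<bar>d x\<bar> \<le> K * \<bar>u x - v x\<bar>"
    "\<And>x. x \<in> {0..T} - N' \<Longrightarrow> d x = - (f x (u x) - f x (v x))"
proof -
  have w: "lip_deriv T (\<lambda>x. u x - v x) (\<lambda>x. u' x - v' x)"
  proof (rule lip_deriv_C1)
    show "((\<lambda>x. u x - v x) has_real_derivative u' x - v' x) (at x within {0..T})" if "x \<in> {0..T}" for x
      using u v that unfolding ode_solution_def by (intro DERIV_diff) auto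
    show "continuous_on {0..T} (\<lambda>x. u' x - v' x)"
      using u v unfolding ode_solution_def by (intro continuous_intros) auto
  qed
  obtain B where B: "B > 0" "\<And>x. x \<in> {0..T} \<Longrightarrow> \<bar>u x - v x\<bar> \<le> B"
    using lip_deriv_bounded[OF w] by blast
  from u have "AE x in lebesgue_on {0<..<T}. \<exists>w. (u' has_real_derivative w) (at x) \<and> w + f x (u x) = 0"
    by (simp add: ode_solution_def)
  then obtain N1 where N1: "negligible N1" and
    du: "\<And>x. x \<in> {0..T} - N1 \<Longrightarrow> \<exists>w. (u' has_real_derivative w) (at x) \<and> w + f x (u x) = 0"
    by (rule AE_open_intervalE) (rule that)
  from v have "AE x in lebesgue_on {0<..<T}. \<exists>w. (v' has_real_derivative w) (at x) \<and> w + f x (v x) = 0"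
    by (simp add: ode_solution_def)
  then obtain N2 where N2: "negligible N2" and
    dv: "\<And>x. x \<in> {0..T} - N2 \<Longrightarrow> \<exists>w. (v' has_real_derivative w) (at x) \<and> w + f x (v x) = 0"
    by (rule AE_open_intervalE) (rule that)
  define N' where "N' = N \<union> (N1 \<union> N2)"
  have N': "negligible N'" using N N1 N2 by (simp add: N'_def)
  define d where "d x = (if x \<in> N' then 0 else - (f x (u x) - f x (v x)))" for x
  have dw: "((\<lambda>x. u' x - v' x) has_real_derivative d x) (at x within {0..T})" if x: "x \<in> {0..T} - N'" for x
  proof -
    from x have "x \<in> {0..T} - N1" "x \<in> {0..T} - N2" by (auto simp: N'_def)
    from du[OF this(1)] dv[OF this(2)] obtain a b where
      a: "(u' has_real_derivative a) (at x)" "a + f x (u x) = 0" and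
      b: "(v' has_real_derivative b) (at x)" "b + f x (v x) = 0" by blast
    have "d x = a - b" using a b x by (simp add: d_def)
    then show ?thesis using DERIV_diff[OF a(1) b(1)] by (simp add: has_field_derivative_at_within)
  qed
  have db: "\<bar>d x\<bar> \<le> K * \<bar>u x - v x\<bar>" if "x \<in> {0..T}" for x
    using lip[of x "u x" "v x"] that K by (auto simp: d_def N'_def)
  have w': "lip_deriv T (\<lambda>x. u' x - v' x) d"
  proof (rule abs_continuous_imp_lip_deriv[OF _ N' dw])
    show "abs_continuous_on_interval 0 T (\<lambda>x. u' x - v' x)"
      using u v unfolding ode_solution_def by (intro abs_continuous_on_diff) auto
    show "\<bar>d x\<bar> \<le> K * B" if "x \<in> {0..T} - N'" for x
      using db[of x] B(2)[of x] that K mult_left_mono[of "\<bar>u x - v x\<bar>" B K] by simp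
  qed (use K B in auto)
  show thesis by (rule that[OF N' _ w w' db]) (auto simp: N'_def d_def)
qed

lemma lip_deriv_integral:
  assumes g: "g absolutely_integrable_on {0..T}" and b: "\<And>x. x \<in> {0..T} \<Longrightarrow> \<bar>g x\<bar> \<le> B" and B: "B \<ge> 0"
  shows "lip_deriv T (\<lambda>x. integral {0..x} g) g"
proof -
  obtain N where N: "negligible N" and
    d: "\<And>x. x \<in> {0..T} - N \<Longrightarrow> ((\<lambda>x. integral {0..x} g) has_real_derivative g x) (at x within {0..T})"
    by (rule lebesgue_differentiation[OF g]) blast
  show ?thesis
    by (rule abs_continuous_imp_lip_deriv[OF abs_continuous_integral[OF g] N d _ B]) (use b in auto)
qed

text \<open>The left-hand side is the derivative of \<open>w\<^sup>2 + v\<^sup>2\<close> along \<open>w' = \<mu> v\<close>, \<open>v' = e\<close>.\<close>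

lemma energy_rate_bound:
  fixes \<mu> K w v e :: real
  assumes \<mu>: "\<mu> > 0" and K: "K \<ge> 0" and e: "\<bar>\<mu> * e\<bar> \<le> K * \<bar>w\<bar>"
  shows "\<bar>2 * (\<mu> * v * w + e * v)\<bar> \<le> (\<mu> + K / \<mu>) * (w\<^sup>2 + v\<^sup>2)"
proof -
  have q: "2 * (\<bar>v\<bar> * \<bar>w\<bar>) \<le> w\<^sup>2 + v\<^sup>2"
    using sum_squares_bound[of "\<bar>v\<bar>" "\<bar>w\<bar>"] by simp
  have e': "\<bar>e\<bar> \<le> K / \<mu> * \<bar>w\<bar>" using e \<mu> by (simp add: abs_mult field_simps)
  have "\<bar>2 * (\<mu> * v * w + e * v)\<bar> \<le> 2 * (\<mu> * \<bar>v\<bar> * \<bar>w\<bar> + \<bar>e\<bar> * \<bar>v\<bar>)"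
    using abs_triangle_ineq[of "\<mu> * v * w" "e * v"] \<mu> by (simp add: abs_mult del: distrib_left_numeral)
  also have "\<dots> \<le> 2 * (\<mu> * \<bar>v\<bar> * \<bar>w\<bar> + (K / \<mu> * \<bar>w\<bar>) * \<bar>v\<bar>)"
    using e' by (intro mult_left_mono add_left_mono mult_right_mono) auto
  also have "\<dots> = (\<mu> + K / \<mu>) * (2 * (\<bar>v\<bar> * \<bar>w\<bar>))" by (simp add: algebra_simps)
  also have "\<dots> \<le> (\<mu> + K / \<mu>) * (w\<^sup>2 + v\<^sup>2)" using q \<mu> K by (intro mult_left_mono) auto
  finally show ?thesis .
qed

lemma energy_lip_deriv:
  assumes "lip_deriv T w (\<lambda>x. \<mu> * v x)" "lip_deriv T v e"
  shows "lip_deriv T (\<lambda>x. (w x)\<^sup>2 + (v x)\<^sup>2) (\<lambda>x. 2 * (\<mu> * v x * w x + e x * v x))"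
  using lip_deriv_add[OF lip_deriv_mult[OF assms(1) assms(1)] lip_deriv_mult[OF assms(2) assms(2)]]
  by (simp add: power2_eq_square algebra_simps)

lemma energy_gronwall:
  assumes "\<mu> > 0" "K \<ge> 0" "lip_deriv T w (\<lambda>x. \<mu> * v x)" "lip_deriv T v e"
    and "\<And>x. x \<in> {0..T} \<Longrightarrow> \<bar>\<mu> * e x\<bar> \<le> K * \<bar>w x\<bar>" and t: "0 \<le> t" "t \<le> T"
  shows "(w t)\<^sup>2 + (v t)\<^sup>2 \<le> exp ((\<mu> + K / \<mu>) * t) * ((w 0)\<^sup>2 + (v 0)\<^sup>2)"
    and "(w 0)\<^sup>2 + (v 0)\<^sup>2 \<le> exp ((\<mu> + K / \<mu>) * t) * ((w t)\<^sup>2 + (v t)\<^sup>2)"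
  using gronwall[OF energy_lip_deriv[OF assms(3,4)] negligible_empty _ order_refl t, of "\<mu> + K / \<mu>"]
    energy_rate_bound[OF assms(1,2,5)] by auto

text \<open>Polar coordinates \<open>v = p cos \<theta>\<close>, \<open>w = p sin \<theta>\<close> for the phase vector, where \<open>v = w' / \<mu>\<close>. The angle is
  defined as the integral of the angular velocity \<open>g = (v w' - w v') / (w\<^sup>2 + v\<^sup>2)\<close>. To see that it is
  the right angle, rotate the phase vector back by \<open>\<theta>\<close>: its transversal component \<open>q\<close> satisfies
  \<open>q' = k q\<close> with bounded \<open>k\<close> and starts at zero. The radius \<open>p\<close> is continuous and never zero, hence
  positive. The coefficient of the linear equation enters only through \<open>- w w''\<close>, which lies
  between \<open>\<alpha> w\<^sup>2\<close> and \<open>\<beta> w\<^sup>2\<close>.\<close>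

lemma pruefer_angle:
  assumes \<mu>: "\<mu> > 0" and K: "K \<ge> 0" and T: "T \<ge> 0"
    and w: "lip_deriv T w (\<lambda>x. \<mu> * v x)" and v: "lip_deriv T v e"
    and eb: "\<And>x. x \<in> {0..T} \<Longrightarrow> \<bar>\<mu> * e x\<bar> \<le> K * \<bar>w x\<bar>"
    and N: "negligible N"
    and ab: "\<And>x. x \<in> {0..T} - N \<Longrightarrow> \<alpha> x * (w x)\<^sup>2 \<le> - (\<mu> * e x * w x) \<and> - (\<mu> * e x * w x) \<le> \<beta> x * (w x)\<^sup>2"
    and nz: "(w 0)\<^sup>2 + (v 0)\<^sup>2 > 0"
  obtains \<theta> g r where "lip_deriv T \<theta> g" "r > 0"
    "w 0 = sqrt ((w 0)\<^sup>2 + (v 0)\<^sup>2) * sin (\<theta> 0)" "v 0 = sqrt ((w 0)\<^sup>2 + (v 0)\<^sup>2) * cos (\<theta> 0)"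
    "w T = r * sin (\<theta> T)" "v T = r * cos (\<theta> T)"
    "\<And>x. x \<in> {0..T} - N \<Longrightarrow> \<mu> + (\<alpha> x - \<mu>\<^sup>2) / \<mu> * (sin (\<theta> x))\<^sup>2 \<le> g x"
    "\<And>x. x \<in> {0..T} - N \<Longrightarrow> g x \<le> \<mu> + (\<beta> x - \<mu>\<^sup>2) / \<mu> * (sin (\<theta> x))\<^sup>2"
proof -
  define E where "E x = (w x)\<^sup>2 + (v x)\<^sup>2" for x
  define M where "M = \<mu> + K / \<mu>"
  have E0: "E x > 0" if "x \<in> {0..T}" for x
  proof (rule ccontr)
    assume "\<not> E x > 0"
    then have "E x = 0" by (simp add: E_def not_less sum_power2_le_zero_iff)
    moreover have "E 0 \<le> exp (M * x) * E x"
      unfolding E_def M_def by (rule energy_gronwall(2)[OF \<mu> K w v eb]) (use that in auto)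
    ultimately show False using nz by (simp add: E_def)
  qed
  note wc = lip_deriv_continuous[OF w] and vc = lip_deriv_continuous[OF v]
  have Ec: "continuous_on {0..T} E" unfolding E_def by (intro continuous_intros wc vc)
  define g where "g x = (\<mu> * (v x)\<^sup>2 - w x * e x) / E x" for x
  have "e absolutely_integrable_on {0..T}"
  proof (rule absolutely_integrable_integrable_bound)
    show "norm (e x) \<le> K / \<mu> * \<bar>w x\<bar>" if "x \<in> {0..T}" for x
      using eb[OF that] \<mu> by (simp add: abs_mult field_simps)
    show "e integrable_on {0..T}" using lip_deriv_FTC[OF v, of 0 T] T by (auto simp: integrable_on_def)
    show "(\<lambda>x. K / \<mu> * \<bar>w x\<bar>) integrable_on {0..T}"
      by (intro integrable_continuous_real continuous_intros wc)
  qed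
  moreover have wE: "continuous_on {0..T} (\<lambda>x. w x / E x)"
    by (intro continuous_intros wc Ec) (use E0 in force)
  moreover have "bounded ((\<lambda>x. w x / E x) ` {0..T})"
    by (intro compact_imp_bounded compact_continuous_image wE) simp
  ultimately have "(\<lambda>x. w x / E x * e x) absolutely_integrable_on {0..T}"
    by (intro absolutely_integrable_bounded_measurable_product_real)
      (auto intro: continuous_imp_measurable_on_sets_lebesgue)
  moreover have "(\<lambda>x. \<mu> * (v x)\<^sup>2 / E x) absolutely_integrable_on {0..T}"
    by (intro absolutely_integrable_continuous_real continuous_intros vc Ec) (use E0 in force)
  ultimately have "(\<lambda>x. \<mu> * (v x)\<^sup>2 / E x - w x / E x * e x) absolutely_integrable_on {0..T}"
    by (rule set_integral_diff(1)[rotated])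
  then have g_int: "g absolutely_integrable_on {0..T}"
    by (simp add: g_def[abs_def] diff_divide_distrib)
  have g_bd: "\<bar>g x\<bar> \<le> M" if x: "x \<in> {0..T}" for x
  proof -
    have e': "\<bar>e x\<bar> \<le> K / \<mu> * \<bar>w x\<bar>" using eb[OF x] \<mu> by (simp add: abs_mult field_simps)
    have "\<bar>\<mu> * (v x)\<^sup>2 - w x * e x\<bar> \<le> \<mu> * (v x)\<^sup>2 + \<bar>w x\<bar> * \<bar>e x\<bar>"
      using abs_triangle_ineq4[of "\<mu> * (v x)\<^sup>2" "w x * e x"] \<mu> by (simp add: abs_mult)
    also have "\<dots> \<le> \<mu> * (v x)\<^sup>2 + \<bar>w x\<bar> * (K / \<mu> * \<bar>w x\<bar>)"
      using e' by (intro add_left_mono mult_left_mono) auto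
    also have "\<dots> = \<mu> * (v x)\<^sup>2 + K / \<mu> * (w x)\<^sup>2" by (simp add: power2_eq_square)
    also have "\<dots> \<le> \<mu> * E x + K / \<mu> * E x"
      using \<mu> K by (intro add_mono mult_left_mono) (auto simp: E_def)
    also have "\<dots> = M * E x" by (simp add: M_def algebra_simps)
    finally show ?thesis using E0[OF x] by (simp add: g_def abs_mult pos_divide_le_eq)
  qed
  have M0: "M \<ge> 0" using \<mu> K by (simp add: M_def)
  have "sqrt (E 0) > 0" using nz by (simp add: E_def)
  have "(w 0 / sqrt (E 0))\<^sup>2 + (v 0 / sqrt (E 0))\<^sup>2 = 1"
  proof -
    have "(sqrt (E 0))\<^sup>2 = E 0" "E 0 \<noteq> 0" using nz E0[of 0] T by auto
    then show ?thesis
      by (simp only: power_divide add_divide_distrib[symmetric] E_def[of 0, symmetric] divide_self simp_thms)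
  qed
  then obtain \<theta>0 where \<theta>0: "v 0 / sqrt (E 0) = cos \<theta>0" "w 0 / sqrt (E 0) = sin \<theta>0"
    using sincos_total_2pi[of "v 0 / sqrt (E 0)" "w 0 / sqrt (E 0)"] by (auto simp: add.commute)
  define \<theta> where "\<theta> x = \<theta>0 + integral {0..x} g" for x
  have \<theta>: "lip_deriv T \<theta> g"
    using lip_deriv_add[OF lip_deriv_const lip_deriv_integral[OF g_int g_bd M0], of \<theta>0]
    by (simp add: \<theta>_def[abs_def])
  have w0: "w 0 = sqrt (E 0) * sin (\<theta> 0)" and v0: "v 0 = sqrt (E 0) * cos (\<theta> 0)"
    using \<theta>0 \<open>sqrt (E 0) > 0\<close> by (auto simp: \<theta>_def field_simps)
  have C: "lip_deriv T (\<lambda>x. cos (\<theta> x)) (\<lambda>x. - sin (\<theta> x) * g x)"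
    by (rule lip_deriv_chain[OF \<theta>]) (auto intro!: derivative_eq_intros continuous_intros)
  have S: "lip_deriv T (\<lambda>x. sin (\<theta> x)) (\<lambda>x. cos (\<theta> x) * g x)"
    by (rule lip_deriv_chain[OF \<theta>]) (auto intro!: derivative_eq_intros continuous_intros)
  \<comment> \<open>The components of the phase vector across and along the direction \<open>\<theta>\<close>.\<close>
  define q where "q x = w x * cos (\<theta> x) - v x * sin (\<theta> x)" for x
  define p where "p x = v x * cos (\<theta> x) + w x * sin (\<theta> x)" for x
  define k where "k x = (\<mu> * v x * w x + e x * v x) / E x" for x
  have id1: "(cos (\<theta> x))\<^sup>2 = 1 - (sin (\<theta> x))\<^sup>2" for x by (simp add: cos_squared_eq)
  have q: "lip_deriv T q (\<lambda>x. k x * q x)"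
  proof (rule lip_deriv_cong_ae[OF _ negligible_empty])
    show "lip_deriv T q (\<lambda>x. \<mu> * v x * cos (\<theta> x) + w x * (- sin (\<theta> x) * g x) -
        (e x * sin (\<theta> x) + v x * (cos (\<theta> x) * g x)))"
      unfolding q_def[abs_def] by (intro lip_deriv_diff lip_deriv_mult[OF w C] lip_deriv_mult[OF v S])
    fix x assume "x \<in> {0..T} - {}"
    then have E: "E x \<noteq> 0" using E0[of x] by simp
    then have gE: "g x * E x = \<mu> * (v x)\<^sup>2 - w x * e x" and kE: "k x * E x = \<mu> * v x * w x + e x * v x"
      by (simp_all add: g_def k_def)
    have "E x * (\<mu> * v x * cos (\<theta> x) + w x * (- sin (\<theta> x) * g x) -
        (e x * sin (\<theta> x) + v x * (cos (\<theta> x) * g x)))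
      = E x * (\<mu> * v x * cos (\<theta> x) - e x * sin (\<theta> x)) - (g x * E x) * (w x * sin (\<theta> x) + v x * cos (\<theta> x))"
      by (simp add: algebra_simps)
    also have "\<dots> = (k x * E x) * q x"
      unfolding gE kE by (simp add: E_def q_def algebra_simps power2_eq_square)
    also have "\<dots> = E x * (k x * q x)" by simp
    finally show "\<mu> * v x * cos (\<theta> x) + w x * (- sin (\<theta> x) * g x) -
        (e x * sin (\<theta> x) + v x * (cos (\<theta> x) * g x)) = k x * q x" using E by simp
  qed
  have q0: "q x = 0" if "x \<in> {0..T}" for x
  proof -
    have "(q x)\<^sup>2 \<le> exp (M * (x - 0)) * (q 0)\<^sup>2"
    proof (rule gronwall(1)[OF _ negligible_empty])
      show "lip_deriv T (\<lambda>x. (q x)\<^sup>2) (\<lambda>x. 2 * k x * (q x)\<^sup>2)"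
        using lip_deriv_mult[OF q q] by (simp add: power2_eq_square algebra_simps)
      fix x assume x: "x \<in> {0..T} - {}"
      have "\<bar>2 * (\<mu> * v x * w x + e x * v x)\<bar> \<le> M * E x"
        unfolding M_def E_def using energy_rate_bound[OF \<mu> K eb] x by simp
      then have "\<bar>2 * k x\<bar> \<le> M" using E0[of x] x by (simp add: k_def abs_mult pos_divide_le_eq)
      then have "\<bar>2 * k x\<bar> * (q x)\<^sup>2 \<le> M * (q x)\<^sup>2" by (intro mult_right_mono) auto
      then show "\<bar>2 * k x * (q x)\<^sup>2\<bar> \<le> M * (q x)\<^sup>2" by (simp add: abs_mult)
    qed (use that in auto)
    moreover have "q 0 = 0" unfolding q_def by (subst w0, subst v0) simp
    ultimately show ?thesis by simp
  qed
  have wp: "w x = p x * sin (\<theta> x)" and vp: "v x = p x * cos (\<theta> x)" and Ep: "E x = (p x)\<^sup>2"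
    if "x \<in> {0..T}" for x
  proof -
    have "p x * sin (\<theta> x) + q x * cos (\<theta> x) = w x * ((sin (\<theta> x))\<^sup>2 + (cos (\<theta> x))\<^sup>2)"
      unfolding p_def q_def
      by (simp add: algebra_simps power2_eq_square
          del: sin_cos_squared_add sin_cos_squared_add2 sin_cos_squared_add3)
    then show 1: "w x = p x * sin (\<theta> x)" using q0[OF that] by simp
    have "p x * cos (\<theta> x) - q x * sin (\<theta> x) = v x * ((sin (\<theta> x))\<^sup>2 + (cos (\<theta> x))\<^sup>2)"
      unfolding p_def q_def
      by (simp add: algebra_simps power2_eq_square
          del: sin_cos_squared_add sin_cos_squared_add2 sin_cos_squared_add3)
    then show 2: "v x = p x * cos (\<theta> x)" using q0[OF that] by simp
    show "E x = (p x)\<^sup>2" unfolding E_def by (subst 1, subst 2) (simp add: power_mult_distrib id1 algebra_simps)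
  qed
  have p0: "p 0 > 0"
  proof -
    have "p 0 = sqrt (E 0) * ((cos (\<theta> 0))\<^sup>2 + (sin (\<theta> 0))\<^sup>2)"
      unfolding p_def by (subst v0, subst w0) (simp add: power2_eq_square algebra_simps
          del: sin_cos_squared_add sin_cos_squared_add2 sin_cos_squared_add3)
    then show ?thesis using \<open>sqrt (E 0) > 0\<close> by simp
  qed
  have pT: "p T > 0"
  proof (rule ccontr)
    assume "\<not> p T > 0"
    moreover have "continuous_on {0..T} p" unfolding p_def
      by (intro continuous_intros wc vc lip_deriv_continuous[OF \<theta>])
    ultimately obtain x where "0 \<le> x" "x \<le> T" "p x = 0"
      using IVT2'[of p T 0 0] p0 T by auto
    then show False using Ep[of x] E0[of x] by simp
  qed
  show thesis
  proof (rule that[OF \<theta> pT w0[unfolded E_def] v0[unfolded E_def]])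
    show "w T = p T * sin (\<theta> T)" "v T = p T * cos (\<theta> T)" using wp vp T by auto
    fix x assume x: "x \<in> {0..T} - N"
    then have x': "x \<in> {0..T}" by simp
    define Z where "Z = - (\<mu> * e x * w x) / (\<mu> * (p x)\<^sup>2)"
    have pp: "(p x)\<^sup>2 > 0" using E0[OF x'] Ep[OF x'] by simp
    then have p2: "\<mu> * (p x)\<^sup>2 > 0" using \<mu> by simp
    have "g x = \<mu> * (cos (\<theta> x))\<^sup>2 + Z"
      using pp \<mu> unfolding g_def Ep[OF x'] Z_def vp[OF x'] by (simp add: field_simps power_mult_distrib)
    then have gx: "g x = \<mu> - \<mu> * (sin (\<theta> x))\<^sup>2 + Z" by (simp add: id1 algebra_simps)
    have w2: "(w x)\<^sup>2 = (p x)\<^sup>2 * (sin (\<theta> x))\<^sup>2" by (simp add: wp[OF x'] power_mult_distrib)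
    have Zeq: "Z * (\<mu> * (p x)\<^sup>2) = - (\<mu> * e x * w x)" 
      by (rule nonzero_eq_divide_eq[THEN iffD1, OF less_imp_neq[OF p2, THEN not_sym] Z_def])
    have "\<alpha> x / \<mu> * (sin (\<theta> x))\<^sup>2 \<le> Z" "Z \<le> \<beta> x / \<mu> * (sin (\<theta> x))\<^sup>2"
    proof -
      have "\<alpha> x / \<mu> * (sin (\<theta> x))\<^sup>2 * (\<mu> * (p x)\<^sup>2) = \<alpha> x * (w x)\<^sup>2"
        "\<beta> x / \<mu> * (sin (\<theta> x))\<^sup>2 * (\<mu> * (p x)\<^sup>2) = \<beta> x * (w x)\<^sup>2" using \<mu> by (simp_all add: w2)
      then show "\<alpha> x / \<mu> * (sin (\<theta> x))\<^sup>2 \<le> Z" "Z \<le> \<beta> x / \<mu> * (sin (\<theta> x))\<^sup>2"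
        using ab[OF x] Zeq p2 by (metis mult_le_cancel_right_pos)+
    qed
    moreover have "(a - \<mu>\<^sup>2) / \<mu> * s = a / \<mu> * s - \<mu> * s" for a s
      using \<mu> by (simp add: field_simps power2_eq_square)
    ultimately show "\<mu> + (\<alpha> x - \<mu>\<^sup>2) / \<mu> * (sin (\<theta> x))\<^sup>2 \<le> g x"
      "g x \<le> \<mu> + (\<beta> x - \<mu>\<^sup>2) / \<mu> * (sin (\<theta> x))\<^sup>2" using gx by auto
  qed
qed

section \<open>The rotation exceeds n full turns\<close>

lemma lip_deriv_increment_ge:
  assumes \<theta>: "lip_deriv T \<theta> g" and N: "negligible N" and st: "0 \<le> s" "s \<le> t" "t \<le> T"
    and a: "(a has_integral I) {s..t}" and b: "\<And>x. x \<in> {s..t} - N \<Longrightarrow> a x \<le> g x"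
  shows "I \<le> \<theta> t - \<theta> s"
  by (rule has_integral_le_ae[OF a lip_deriv_FTC[OF \<theta> st] N b])

lemma lip_deriv_increment_le:
  assumes \<theta>: "lip_deriv T \<theta> g" and N: "negligible N" and st: "0 \<le> s" "s \<le> t" "t \<le> T"
    and a: "(a has_integral I) {s..t}" and b: "\<And>x. x \<in> {s..t} - N \<Longrightarrow> g x \<le> a x"
  shows "\<theta> t - \<theta> s \<le> I"
  by (rule has_integral_le_ae[OF lip_deriv_FTC[OF \<theta> st] a N b])

lemma has_integral_const_Icc: "s \<le> t \<Longrightarrow> ((\<lambda>x. c) has_integral c * (t - s)) {s..t}" for c s t :: real
  using has_integral_const_real[of c s t] by (simp add: mult.commute)

text \<open>From \<open>sin\<^sup>2 x + sin\<^sup>2 y = 1 - cos (x + y) * cos (y - x)\<close>: two angles whose distance is bounded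
  away from \<open>0\<close> and \<open>\<pi>\<close> cannot both be close to a zero of \<open>sin\<close>.\<close>

lemma sin_squares_separated:
  fixes x y \<kappa> :: real
  assumes "0 \<le> \<kappa>" "\<kappa> \<le> y - x" "y - x \<le> pi / 2"
  shows "1 - cos \<kappa> \<le> (sin x)\<^sup>2 + (sin y)\<^sup>2"
proof -
  have c: "0 \<le> cos (y - x)" "cos (y - x) \<le> cos \<kappa>"
    using assms by (auto intro!: cos_ge_zero cos_monotone_0_pi_le)
  have "(sin x)\<^sup>2 + (sin y)\<^sup>2 = 1 - cos (x + y) * cos (y - x)"
  proof -
    have "cos (x + y) * cos (y - x) = (cos x)\<^sup>2 * (cos y)\<^sup>2 - (sin x)\<^sup>2 * (sin y)\<^sup>2"
      by (simp add: cos_add cos_diff power2_eq_square algebra_simps)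
    then show ?thesis by (simp add: cos_squared_eq algebra_simps)
  qed
  moreover have "cos (x + y) * cos (y - x) \<le> 1 * cos (y - x)"
    using c by (intro mult_right_mono) auto
  ultimately show ?thesis using c by simp
qed

text \<open>One of the pieces of a fine equidistant partition must contribute to the total increase.\<close>

lemma increasing_on_short_interval:
  fixes G :: "real \<Rightarrow> real"
  assumes T: "T > 0" and h: "h > 0" and G: "G 0 < G T"
  obtains p q where "0 \<le> p" "p < q" "q \<le> T" "q - p \<le> h" "G p < G q"
proof -
  obtain m :: nat where m: "T / h < real m" using reals_Archimedean2 by blast
  moreover have "T / h > 0" using T h by simp
  ultimately have m0: "real m > 0" by linarith
  define r where "r = T / real m"
  have r: "r > 0" "r < h" using T h m m0 by (auto simp: r_def field_simps)
  have "\<exists>j<m. G (real j * r) < G (real (Suc j) * r)"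
  proof (rule ccontr)
    assume neg: "\<not> ?thesis"
    have "j \<le> m \<Longrightarrow> G (real j * r) \<le> G 0" for j
    proof (induction j)
      case (Suc j)
      then have "\<not> G (real j * r) < G (real (Suc j) * r)" using neg by auto
      then show ?case using Suc by simp
    qed simp
    from this[of m] have "G T \<le> G 0" using m0 by (simp add: r_def)
    then show False using G by simp
  qed
  then obtain j where j: "j < m" "G (real j * r) < G (real (Suc j) * r)" by blast
  have "real (Suc j) * r \<le> real m * r" using j r by (intro mult_right_mono) auto
  also have "\<dots> = T" using m0 by (simp add: r_def)
  finally have "real (Suc j) * r \<le> T" .
  then show thesis
    using that[of "real j * r" "real (Suc j) * r"] j r by (simp add: algebra_simps)
qed

text \<open>Choose an interval on which \<open>A\<close> has positive mass and which is so short that \<open>\<theta>\<close> moves by at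
  most \<open>\<pi> / 2\<close> on it, and cut it into three parts of equal mass \<open>c\<close>. While the middle part is
  traversed, \<open>\<theta>\<close> advances by at least \<open>\<kappa>\<close>. By \<open>sin_squares_separated\<close> the smallest values of
  \<open>sin\<^sup>2 \<theta>\<close> on the outer two parts add up to at least \<open>1 - cos \<kappa>\<close>, so the term with \<open>A\<close> contributes at
  least \<open>c * (1 - cos \<kappa>) / \<mu>\<close> to the rotation. Everything here is independent of \<open>\<theta>\<close>.\<close>

lemma rotation_excess:
  assumes T: "T > 0" and \<mu>: "0 < \<mu>" and A: "A integrable_on {0..T}" and pos: "integral {0..T} A > 0"
    and N: "negligible N" and A0: "\<And>x. x \<in> {0..T} - N \<Longrightarrow> A x \<ge> 0"
  obtains \<epsilon> where "\<epsilon> > 0"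
    "\<And>\<theta> g N'. lip_deriv T \<theta> g \<Longrightarrow> negligible N' \<Longrightarrow>
       (\<And>x. x \<in> {0..T} - N' \<Longrightarrow> \<mu> + A x / \<mu> * (sin (\<theta> x))\<^sup>2 \<le> g x \<and> g x \<le> L) \<Longrightarrow>
       \<theta> T - \<theta> 0 \<ge> \<mu> * T + \<epsilon>"
proof -
  \<comment> \<open>\<open>L\<close> could be smaller than \<open>\<mu>\<close> if no \<open>\<theta>\<close> as in the conclusion exists.\<close>
  define L' where "L' = max L \<mu>"
  have L': "L' > 0" "\<mu> \<le> L'" using \<mu> by (auto simp: L'_def)
  define G where "G t = integral {0..t} A" for t
  have Gc: "continuous_on {0..T} G" unfolding G_def by (rule indefinite_integral_continuous_1[OF A])
  have Aint: "(A has_integral (G t - G s)) {s..t}" if "0 \<le> s" "s \<le> t" "t \<le> T" for s t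
  proof -
    have "A integrable_on {0..t}" "A integrable_on {s..t}"
      using that by (auto intro: integrable_subinterval_real[OF A])
    then show ?thesis
      using Henstock_Kurzweil_Integration.integral_combine[of 0 s t A] that
      by (simp add: G_def has_integral_iff)
  qed
  have "pi / (2 * L') > 0" using L' by simp
  moreover have "G 0 < G T" using pos by (simp add: G_def)
  ultimately obtain p q where pq: "0 \<le> p" "p < q" "q \<le> T" "q - p \<le> pi / (2 * L')" "G p < G q"
    by (rule increasing_on_short_interval[OF T])
  define c where "c = (G q - G p) / 3"
  have c: "c > 0" using pq by (simp add: c_def)
  have Gq: "G q = G p + 3 * c" by (simp add: c_def field_simps)
  have "\<exists>y1. p \<le> y1 \<and> y1 \<le> q \<and> G y1 = G p + c"
    by (rule IVT') (use pq c Gq in \<open>auto intro: continuous_on_subset[OF Gc]\<close>)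
  then obtain y1 where y1: "p \<le> y1" "y1 \<le> q" "G y1 = G p + c" by blast
  have "\<exists>y2. y1 \<le> y2 \<and> y2 \<le> q \<and> G y2 = G p + 2 * c"
    by (rule IVT') (use pq c y1 Gq in \<open>auto intro: continuous_on_subset[OF Gc]\<close>)
  then obtain y2 where y2: "y1 \<le> y2" "y2 \<le> q" "G y2 = G p + 2 * c" by blast
  have "y1 \<noteq> y2" using y1 y2 c by auto
  then have y12: "y1 < y2" using y2 by simp
  define \<kappa> where "\<kappa> = \<mu> * (y2 - y1)"
  have \<kappa>0: "\<kappa> > 0" using y12 \<mu> by (simp add: \<kappa>_def)
  have lenL: "L' * (t - s) \<le> pi / 2" if "p \<le> s" "t \<le> q" for s t
  proof -
    have "L' * (t - s) \<le> L' * (pi / (2 * L'))" using that pq L' by (intro mult_left_mono) auto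
    then show ?thesis using L' by simp
  qed
  have "\<kappa> \<le> L' * (y2 - y1)" unfolding \<kappa>_def using L' y12 by (intro mult_right_mono) auto
  then have \<kappa>1: "\<kappa> \<le> pi / 2" using lenL[of y1 y2] y1 y2 by linarith
  have "cos \<kappa> < 1"
    using cos_monotone_0_pi[of 0 \<kappa>] \<kappa>0 \<kappa>1 pi_gt_zero by simp
  then have "c * (1 - cos \<kappa>) / \<mu> > 0" using c \<mu> by simp
  then show thesis
  proof (rule that)
    fix \<theta> g N'
    assume \<theta>: "lip_deriv T \<theta> g" and N': "negligible N'"
      and g: "\<And>x. x \<in> {0..T} - N' \<Longrightarrow> \<mu> + A x / \<mu> * (sin (\<theta> x))\<^sup>2 \<le> g x \<and> g x \<le> L"
    have neg: "negligible (N \<union> N')" using N N' by simp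
    have g\<mu>: "\<mu> \<le> g x" if "x \<in> {0..T} - (N \<union> N')" for x
    proof -
      have "0 \<le> A x / \<mu> * (sin (\<theta> x))\<^sup>2" using A0[of x] that \<mu> by simp
      then show ?thesis using g[of x] that by force
    qed
    have inc: "\<mu> * (t - s) \<le> \<theta> t - \<theta> s" if "0 \<le> s" "s \<le> t" "t \<le> T" for s t
      by (rule lip_deriv_increment_ge[OF \<theta> neg that has_integral_const_Icc[OF that(2)] g\<mu>]) (use that in auto)
    have dec: "\<theta> t - \<theta> s \<le> L' * (t - s)" if "0 \<le> s" "s \<le> t" "t \<le> T" for s t
    proof (rule lip_deriv_increment_le[OF \<theta> neg that has_integral_const_Icc[OF that(2)]])
      fix x assume "x \<in> {s..t} - (N \<union> N')"
      then have "g x \<le> L" using g[of x] that by simp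
      then show "g x \<le> L'" by (simp add: L'_def)
    qed
    have gain: "\<exists>z\<in>{s..t}. \<mu> * (t - s) + (G t - G s) / \<mu> * (sin (\<theta> z))\<^sup>2 \<le> \<theta> t - \<theta> s"
      if st: "0 \<le> s" "s \<le> t" "t \<le> T" for s t
    proof -
      have "continuous_on {s..t} (\<lambda>x. (sin (\<theta> x))\<^sup>2)"
        by (intro continuous_intros continuous_on_subset[OF lip_deriv_continuous[OF \<theta>]]) (use st in auto)
      then obtain z where z: "z \<in> {s..t}" "\<forall>x\<in>{s..t}. (sin (\<theta> z))\<^sup>2 \<le> (sin (\<theta> x))\<^sup>2"
        using continuous_attains_inf[of "{s..t}" "\<lambda>x. (sin (\<theta> x))\<^sup>2"] st by auto
      have "((\<lambda>x. \<mu> + (sin (\<theta> z))\<^sup>2 / \<mu> * A x) has_integral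
          \<mu> * (t - s) + (sin (\<theta> z))\<^sup>2 / \<mu> * (G t - G s)) {s..t}"
        by (intro has_integral_add has_integral_mult_right has_integral_const_Icc Aint st)
      then have "\<mu> * (t - s) + (sin (\<theta> z))\<^sup>2 / \<mu> * (G t - G s) \<le> \<theta> t - \<theta> s"
      proof (rule lip_deriv_increment_ge[OF \<theta> neg st])
        fix x assume x: "x \<in> {s..t} - (N \<union> N')"
        have "A x * (sin (\<theta> z))\<^sup>2 \<le> A x * (sin (\<theta> x))\<^sup>2"
          using A0[of x] z(2) x st by (intro mult_left_mono) auto
        then have "(sin (\<theta> z))\<^sup>2 / \<mu> * A x \<le> A x / \<mu> * (sin (\<theta> x))\<^sup>2"
          using \<mu> by (simp add: field_simps)
        then show "\<mu> + (sin (\<theta> z))\<^sup>2 / \<mu> * A x \<le> g x" using g[of x] x st by force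
      qed
      then show ?thesis using z(1) by (auto simp: mult.commute)
    qed
    obtain z1 where z1: "z1 \<in> {p..y1}" "\<mu> * (y1 - p) + c / \<mu> * (sin (\<theta> z1))\<^sup>2 \<le> \<theta> y1 - \<theta> p"
      using gain[of p y1] pq y1 y2 by auto
    obtain z2 where z2: "z2 \<in> {y2..q}" "\<mu> * (q - y2) + c / \<mu> * (sin (\<theta> z2))\<^sup>2 \<le> \<theta> q - \<theta> y2"
      using gain[of y2 q] pq y1 y2 Gq by auto
    have "1 - cos \<kappa> \<le> (sin (\<theta> z1))\<^sup>2 + (sin (\<theta> z2))\<^sup>2"
    proof (rule sin_squares_separated)
      have "\<mu> * (y2 - y1) \<le> \<mu> * (z2 - z1)" using \<mu> z1 z2 by (intro mult_left_mono) auto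
      then show "\<kappa> \<le> \<theta> z2 - \<theta> z1" using inc[of z1 z2] z1 z2 pq y12 by (simp add: \<kappa>_def)
      show "\<theta> z2 - \<theta> z1 \<le> pi / 2" using dec[of z1 z2] lenL[of z1 z2] z1 z2 pq y12 by simp
    qed (use \<kappa>0 in simp)
    then have "c / \<mu> * (1 - cos \<kappa>) \<le> c / \<mu> * ((sin (\<theta> z1))\<^sup>2 + (sin (\<theta> z2))\<^sup>2)"
      using c \<mu> by (intro mult_left_mono) auto
    then have "c * (1 - cos \<kappa>) / \<mu> \<le> c / \<mu> * (sin (\<theta> z1))\<^sup>2 + c / \<mu> * (sin (\<theta> z2))\<^sup>2"
      by (simp add: distrib_left)
    then show "\<mu> * T + c * (1 - cos \<kappa>) / \<mu> \<le> \<theta> T - \<theta> 0"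
      using inc[of 0 p] inc[of y1 y2] inc[of q T] z1(2) z2(2) pq y1 y2 by (simp add: right_diff_distrib)
  qed
qed

section \<open>The rotation stays below n + 1 full turns\<close>

lemma sin_less_self:
  fixes x :: real
  assumes "0 < x" "x \<le> pi"
  shows "sin x < x"
proof (cases "x \<le> pi / 2")
  case True
  have "x - sin x > 0 - sin 0"
  proof (rule DERIV_pos_imp_increasing_open[OF assms(1)])
    fix y assume y: "0 < y" "y < x"
    then have "cos y < 1" using cos_monotone_0_pi[of 0 y] assms by simp
    moreover have "((\<lambda>x. x - sin x) has_real_derivative 1 - cos y) (at y)"
      by (auto intro!: derivative_eq_intros)
    ultimately show "\<exists>d. ((\<lambda>x. x - sin x) has_real_derivative d) (at y) \<and> d > 0"
      by (intro exI[of _ "1 - cos y"]) simp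
  qed (intro continuous_intros)
  then show ?thesis by simp
next
  case False
  have "sin x \<le> 1" by simp
  also have "1 < x" using False pi_gt3 by simp
  finally show ?thesis .
qed

text \<open>The largest function of the angle \<open>y\<close> that is bounded by \<open>\<mu> / sin\<^sup>2 \<delta>\<close> and whose product with
  \<open>sin\<^sup>2 y\<close> is bounded by \<open>\<mu>\<close>.\<close>

definition weight :: "real \<Rightarrow> real \<Rightarrow> real \<Rightarrow> real" where
  "weight \<mu> \<delta> y = \<mu> / max ((sin \<delta>)\<^sup>2) ((sin y)\<^sup>2)"

lemma weight_bounds:
  assumes "\<mu> > 0" "sin \<delta> > 0"
  shows "0 < weight \<mu> \<delta> y" "weight \<mu> \<delta> y \<le> \<mu> / (sin \<delta>)\<^sup>2" "weight \<mu> \<delta> y * (sin y)\<^sup>2 \<le> \<mu>"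
proof -
  define m where "m = max ((sin \<delta>)\<^sup>2) ((sin y)\<^sup>2)"
  have s: "(sin \<delta>)\<^sup>2 > 0" using assms by simp
  have m: "(sin \<delta>)\<^sup>2 \<le> m" "(sin y)\<^sup>2 \<le> m" by (simp_all add: m_def)
  then have m0: "m > 0" using s by linarith
  have w: "weight \<mu> \<delta> y = \<mu> / m" by (simp add: weight_def m_def)
  show "0 < weight \<mu> \<delta> y" using w m0 assms by simp
  show "weight \<mu> \<delta> y \<le> \<mu> / (sin \<delta>)\<^sup>2" unfolding w using m s m0 assms by (intro divide_left_mono) auto
  have "\<mu> / m * (sin y)\<^sup>2 \<le> \<mu> / m * m" using m m0 assms by (intro mult_left_mono) auto
  then show "weight \<mu> \<delta> y * (sin y)\<^sup>2 \<le> \<mu>" using w m0 by simp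
qed

lemma weight_continuous:
  assumes "sin \<delta> > 0"
  shows "continuous_on S (weight \<mu> \<delta>)"
proof -
  have "max ((sin \<delta>)\<^sup>2) ((sin y)\<^sup>2) \<noteq> 0" for y using assms
    by (metis less_max_iff_disj less_irrefl zero_less_power)
  then show ?thesis unfolding weight_def[abs_def] by (intro continuous_intros) auto
qed

lemma continuous_antiderivative:
  fixes h :: "real \<Rightarrow> real"
  assumes "continuous_on UNIV h"
  obtains H where "\<And>y. (H has_real_derivative h y) (at y)"
proof -
  have "\<exists>F. \<forall>x. (-\<infinity>::ereal) < ereal x \<longrightarrow> ereal x < \<infinity> \<longrightarrow> (F has_vector_derivative h x) (at x)"
    by (rule einterval_antiderivative) (use assms in \<open>auto simp: continuous_on_eq_continuous_at\<close>)
  then show thesis using that by (auto simp: has_real_derivative_iff_has_vector_derivative)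
qed

text \<open>The increment over a half turn is twice the integral over \<open>[0, \<pi> / 2]\<close>, where the weight is constant
  up to \<open>\<delta>\<close> and is the derivative of \<open>- \<mu> * cot\<close> afterwards. Reflection at \<open>\<pi> / 2\<close> and the period \<open>\<pi>\<close>
  of the weight transfer this to all half turns.\<close>

lemma weight_antiderivative:
  assumes \<mu>: "\<mu> > 0" and \<delta>: "0 < \<delta>" "\<delta> < pi / 2"
  obtains H where "\<And>y. (H has_real_derivative weight \<mu> \<delta> y) (at y)"
    "\<And>y. H (y + pi) - H y = 2 * (\<mu> * \<delta> / (sin \<delta>)\<^sup>2 + \<mu> * cot \<delta>)"
proof -
  have s\<delta>: "sin \<delta> > 0" using \<delta> by (intro sin_gt_zero) auto
  obtain H where H: "\<And>y. (H has_real_derivative weight \<mu> \<delta> y) (at y)"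
    using continuous_antiderivative[OF weight_continuous[OF s\<delta>]] by blast
  have FTC: "(weight \<mu> \<delta> has_integral (H b - H a)) {a..b}" if "a \<le> b" for a b
    by (rule fundamental_theorem_of_calculus[OF that],
        subst has_real_derivative_iff_has_vector_derivative[symmetric], rule has_field_derivative_at_within[OF H])
  have "((\<lambda>y. \<mu> / (sin \<delta>)\<^sup>2) has_integral (H \<delta> - H 0)) {0..\<delta>}"
  proof (rule has_integral_eq[OF _ FTC])
    fix y assume y: "y \<in> {0..\<delta>}"
    then have "0 \<le> sin y" "sin y \<le> sin \<delta>" using \<delta> by (auto intro!: sin_ge_zero sin_monotone_2pi_le)
    then have "(sin y)\<^sup>2 \<le> (sin \<delta>)\<^sup>2" by (intro power_mono) auto
    then show "weight \<mu> \<delta> y = \<mu> / (sin \<delta>)\<^sup>2" by (simp add: weight_def max_absorb1)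
  qed (use \<delta> in simp)
  then have i1: "H \<delta> - H 0 = \<mu> * \<delta> / (sin \<delta>)\<^sup>2"
    using has_integral_unique[OF _ has_integral_const_real[of "\<mu> / (sin \<delta>)\<^sup>2" 0 \<delta>]] \<delta>
    by (simp add: mult.commute)
  have "((\<lambda>y. \<mu> / (sin y)\<^sup>2) has_integral (H (pi / 2) - H \<delta>)) {\<delta>..pi/2}"
  proof (rule has_integral_eq[OF _ FTC])
    fix y assume y: "y \<in> {\<delta>..pi/2}"
    then have "sin \<delta> \<le> sin y" using \<delta> by (auto intro!: sin_monotone_2pi_le)
    then have "(sin \<delta>)\<^sup>2 \<le> (sin y)\<^sup>2" using s\<delta> by (intro power_mono) auto
    then show "weight \<mu> \<delta> y = \<mu> / (sin y)\<^sup>2" by (simp add: weight_def max_absorb2)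
  qed (use \<delta> in simp)
  from has_integral_unique[OF this] have i2: "H (pi / 2) - H \<delta> = \<mu> * cot \<delta>"
    if "((\<lambda>y. \<mu> / (sin y)\<^sup>2) has_integral (\<mu> * cot \<delta>)) {\<delta>..pi/2}" using that .
  have "((\<lambda>y. \<mu> / (sin y)\<^sup>2) has_integral (- \<mu> * cot (pi/2) - (- \<mu> * cot \<delta>))) {\<delta>..pi/2}"
  proof (rule fundamental_theorem_of_calculus)
    fix y assume y: "y \<in> {\<delta>..pi/2}"
    then have "0 < y" "y < pi" using \<delta> pi_gt_zero by auto
    then have "sin y > 0" by (rule sin_gt_zero)
    then have "sin y \<noteq> 0" by simp
    from DERIV_cmult[OF DERIV_cot[OF this], of "- \<mu>"]
    have "((\<lambda>y. - \<mu> * cot y) has_real_derivative \<mu> / (sin y)\<^sup>2) (at y)" by (simp add: divide_inverse)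
    then show "((\<lambda>y. - \<mu> * cot y) has_vector_derivative \<mu> / (sin y)\<^sup>2) (at y within {\<delta>..pi/2})"
      by (subst has_real_derivative_iff_has_vector_derivative[symmetric]) (rule has_field_derivative_at_within)
  qed (use \<delta> in simp)
  then have i2: "H (pi / 2) - H \<delta> = \<mu> * cot \<delta>" by (intro i2) (simp add: cot_def)
  have sym: "H (pi - y) + H y = H (pi - z) + H z" for y z
  proof (rule DERIV_isconst_all[where f="\<lambda>y. H (pi - y) + H y"], intro allI)
    fix y
    have "((\<lambda>y. H (pi - y)) has_real_derivative weight \<mu> \<delta> (pi - y) * (- 1)) (at y)"
      by (rule DERIV_chain2[OF H]) (auto intro!: derivative_eq_intros)
    from DERIV_add[OF this H[of y]]
    show "((\<lambda>y. H (pi - y) + H y) has_real_derivative 0) (at y)" by (simp add: weight_def)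
  qed
  have per: "H (y + pi) - H y = H (z + pi) - H z" for y z
  proof (rule DERIV_isconst_all[where f="\<lambda>y. H (y + pi) - H y"], intro allI)
    fix y
    have "((\<lambda>y. H (y + pi)) has_real_derivative weight \<mu> \<delta> (y + pi) * 1) (at y)"
      by (rule DERIV_chain2[OF H]) (auto intro!: derivative_eq_intros)
    from DERIV_diff[OF this H[of y]]
    show "((\<lambda>y. H (y + pi) - H y) has_real_derivative 0) (at y)" by (simp add: weight_def)
  qed
  have "H (y + pi) - H y = 2 * (\<mu> * \<delta> / (sin \<delta>)\<^sup>2 + \<mu> * cot \<delta>)" for y
    using per[of y 0] sym[of 0 "pi / 2"] i1 i2 by simp
  with H show thesis by (rule that)
qed

text \<open>Let \<open>h\<^sub>0\<close> be the weight and \<open>C = \<mu>\<^sup>2 / sin\<^sup>2 \<delta>\<close>, so \<open>\<mu> h\<^sub>0 \<le> C\<close> and \<open>h\<^sub>0 sin\<^sup>2 \<le> \<mu>\<close>. The bound on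
  \<open>g = \<theta>'\<close> gives \<open>h\<^sub>0 g \<le> \<mu> h\<^sub>0 + B\<close>, and \<open>g \<le> L\<close> allows one to add the nonnegative term
  \<open>(C - \<mu> h\<^sub>0) * g / L\<close> on the left if \<open>C - \<mu> h\<^sub>0\<close> is added on the right. So \<open>h g \<le> C + B\<close> holds for
  the tilted weight \<open>h = h\<^sub>0 + (C - \<mu> h\<^sub>0) / L\<close>. The integral of \<open>C + B\<close> is at most \<open>4 (n + 1) P\<close>, where
  \<open>P\<close> is the integral of \<open>h\<^sub>0\<close> over a quarter turn, because \<open>\<mu> T = 4 (n + 1) \<delta>\<close>. The integral of \<open>h\<close> over
  \<open>n + 1\<close> turns exceeds \<open>4 (n + 1) P\<close> by a positive \<open>gap\<close>; as \<open>h \<le> C / \<mu>\<close>, the angle falls short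
  of \<open>n + 1\<close> turns by at least \<open>gap * \<mu> / C\<close>. The inequality \<open>\<pi> - 2 \<delta> > sin (\<pi> - 2 \<delta>)\<close> shows that
  this is positive.\<close>

lemma rotation_deficit:
  assumes T: "T > 0" and n: "n \<ge> 1" and \<mu>_def: "\<mu> = 2 * real n * pi / T" and L\<mu>: "\<mu> \<le> L"
    and \<delta>_def: "\<delta> = real n * pi / (2 * (real n + 1))"
    and B: "(B has_integral I) {0..T}" and I: "I \<le> 4 * (real n + 1) * \<mu> * cot \<delta>"
    and \<theta>: "lip_deriv T \<theta> g" and N: "negligible N"
    and B0: "\<And>x. x \<in> {0..T} - N \<Longrightarrow> B x \<ge> 0"
    and g: "\<And>x. x \<in> {0..T} - N \<Longrightarrow> 0 \<le> g x \<and> g x \<le> L \<and> g x \<le> \<mu> + B x / \<mu> * (sin (\<theta> x))\<^sup>2"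
  shows "\<theta> T - \<theta> 0 \<le> 2 * (real n + 1) * pi - 2 * (real n + 1) * \<mu> / L * (pi - 2 * \<delta> - sin (pi - 2 * \<delta>))"
proof -
  have \<mu>: "\<mu> > 0" using T n by (simp add: \<mu>_def)
  have L: "L > 0" using \<mu> L\<mu> by simp
  have \<delta>: "0 < \<delta>" "\<delta> < pi / 2" using n by (auto simp: \<delta>_def field_simps)
  have s\<delta>: "sin \<delta> > 0" using \<delta> by (intro sin_gt_zero) auto
  define C where "C = \<mu>\<^sup>2 / (sin \<delta>)\<^sup>2"
  have C: "C > 0" using \<mu> s\<delta> by (simp add: C_def)
  define P where "P = \<mu> * \<delta> / (sin \<delta>)\<^sup>2 + \<mu> * cot \<delta>"
  define h where "h y = (1 - \<mu> / L) * weight \<mu> \<delta> y + C / L" for y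
  define k where "k = C / \<mu>"
  obtain H where H: "\<And>y. (H has_real_derivative weight \<mu> \<delta> y) (at y)"
    and Hper: "\<And>y. H (y + pi) - H y = 2 * P"
    unfolding P_def by (rule weight_antiderivative[OF \<mu> \<delta>]) blast
  have C\<mu>: "\<mu> * weight \<mu> \<delta> y \<le> C" for y
    using weight_bounds(2)[OF \<mu> s\<delta>, of y] mult_left_mono[of "weight \<mu> \<delta> y" "\<mu> / (sin \<delta>)\<^sup>2" \<mu>] \<mu>
    by (simp add: C_def power2_eq_square)
  \<comment> \<open>An antiderivative of the tilted weight \<open>h\<close>.\<close>
  define \<Phi> where "\<Phi> y = (1 - \<mu> / L) * H y + C / L * y" for y
  have \<Phi>: "(\<Phi> has_real_derivative h y) (at y)" for y
    unfolding \<Phi>_def h_def by (intro DERIV_add DERIV_cmult H DERIV_cmult_Id)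
  have hc: "continuous_on UNIV h"
    unfolding h_def by (intro continuous_intros weight_continuous s\<delta>)
  have h_eq: "h y = weight \<mu> \<delta> y + (C - \<mu> * weight \<mu> \<delta> y) / L" for y
    using L by (simp add: h_def algebra_simps diff_divide_distrib)
  have h0: "h y > 0" for y
    unfolding h_eq using weight_bounds(1)[OF \<mu> s\<delta>, of y] C\<mu>[of y] L by (simp add: add_pos_nonneg)
  have CT: "C * T = 4 * (real n + 1) * (\<mu> * \<delta> / (sin \<delta>)\<^sup>2)"
  proof -
    have "4 * (real n + 1) * \<delta> = \<mu> * T" using T by (simp add: \<delta>_def \<mu>_def field_simps)
    then have "\<mu> / (sin \<delta>)\<^sup>2 * (\<mu> * T) = \<mu> / (sin \<delta>)\<^sup>2 * (4 * (real n + 1) * \<delta>)" by simp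
    then show ?thesis by (simp add: C_def power2_eq_square algebra_simps)
  qed
  have "\<Phi> (\<theta> T) - \<Phi> (\<theta> 0) \<le> C * (T - 0) + I"
  proof (rule has_integral_le_ae[OF lip_deriv_FTC[OF lip_deriv_chain[OF \<theta> \<Phi> hc]] _ N])
    show "((\<lambda>x. C + B x) has_integral C * (T - 0) + I) {0..T}"
      using has_integral_const_real[of C 0 T] T by (intro has_integral_add B) (simp add: mult.commute)
    fix x assume x: "x \<in> {0..T} - N"
    define W where "W = weight \<mu> \<delta> (\<theta> x)"
    have W: "W > 0" "\<mu> * W \<le> C" "W * (sin (\<theta> x))\<^sup>2 \<le> \<mu>"
      using weight_bounds[OF \<mu> s\<delta>] C\<mu> by (auto simp: W_def)
    have "h (\<theta> x) * g x = W * g x + (C - \<mu> * W) * (g x / L)"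
      by (simp add: h_eq W_def distrib_right)
    also have "(C - \<mu> * W) * (g x / L) \<le> (C - \<mu> * W) * 1"
      using g[OF x] W L by (intro mult_left_mono) auto
    also have "W * g x \<le> W * (\<mu> + B x / \<mu> * (sin (\<theta> x))\<^sup>2)"
      using g[OF x] W by (intro mult_left_mono) auto
    also have "\<dots> = \<mu> * W + B x / \<mu> * (W * (sin (\<theta> x))\<^sup>2)" by (simp add: algebra_simps)
    also have "B x / \<mu> * (W * (sin (\<theta> x))\<^sup>2) \<le> B x / \<mu> * \<mu>"
      using B0[OF x] \<mu> W by (intro mult_left_mono) auto
    finally show "h (\<theta> x) * g x \<le> C + B x" using \<mu> by simp
  qed (use T in auto)
  also have "\<dots> \<le> 4 * (real n + 1) * P"
    using I CT by (simp add: P_def distrib_left mult.assoc)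
  finally have up: "\<Phi> (\<theta> T) - \<Phi> (\<theta> 0) \<le> 4 * (real n + 1) * P" .
  \<comment> \<open>\<open>Q\<close> is the integral of \<open>h\<close> over a half turn.\<close>
  define Q where "Q = (1 - \<mu> / L) * (2 * P) + C / L * pi"
  have shift1: "\<Phi> (z + pi) = \<Phi> z + Q" for z
  proof -
    have "\<Phi> (z + pi) - \<Phi> z = (1 - \<mu> / L) * (H (z + pi) - H z) + C / L * pi"
      by (simp add: \<Phi>_def right_diff_distrib distrib_left)
    then show ?thesis by (simp add: Hper Q_def)
  qed
  have shift: "\<Phi> (y + real m * pi) = \<Phi> y + real m * Q" for m y
  proof (induction m)
    case (Suc m)
    have "y + real (Suc m) * pi = (y + real m * pi) + pi" by (simp add: distrib_right)
    then show ?case using Suc by (simp only: shift1) (simp add: distrib_right)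
  qed simp
  define b where "b = \<theta> 0 + 2 * (real n + 1) * pi"
  define gap where "gap = 2 * (real n + 1) / L * (pi * C - 2 * \<mu> * P)"
  have "\<Phi> b - \<Phi> (\<theta> 0) = 2 * (real n + 1) * Q"
    using shift[of "\<theta> 0" "2 * (n + 1)"] by (simp add: b_def add.commute)
  also have "\<dots> = 4 * (real n + 1) * P + gap"
    unfolding Q_def gap_def using L by (simp add: field_simps)
  finally have low: "gap \<le> \<Phi> b - \<Phi> (\<theta> T)" using up by linarith
  have gap_eq: "gap = k * (2 * (real n + 1) * \<mu> / L * (pi - 2 * \<delta> - sin (pi - 2 * \<delta>)))"
  proof -
    have "cot \<delta> = sin \<delta> * cos \<delta> / (sin \<delta>)\<^sup>2" using s\<delta> by (simp add: cot_def power2_eq_square)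
    then have "pi * C - 2 * \<mu> * P = C * (pi - 2 * \<delta> - 2 * sin \<delta> * cos \<delta>)"
      by (simp add: C_def P_def diff_divide_distrib power2_eq_square algebra_simps)
    moreover have "sin (pi - 2 * \<delta>) = 2 * sin \<delta> * cos \<delta>" by (simp add: sin_double)
    ultimately show ?thesis using \<mu> by (simp add: gap_def k_def)
  qed
  have k: "k > 0" using C \<mu> by (simp add: k_def)
  have "pi - 2 * \<delta> - sin (pi - 2 * \<delta>) > 0" using sin_less_self[of "pi - 2 * \<delta>"] \<delta> by simp
  then have gap0: "gap > 0" unfolding gap_eq using k \<mu> L by (intro mult_pos_pos divide_pos_pos) auto
  have hk: "h y \<le> k" for y
  proof -
    have "h y \<le> weight \<mu> \<delta> y + (C - \<mu> * weight \<mu> \<delta> y) / \<mu>"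
      unfolding h_eq using C\<mu>[of y] \<mu> L L\<mu> by (intro add_left_mono divide_left_mono) auto
    also have "\<dots> = k" using \<mu> by (simp add: k_def diff_divide_distrib)
    finally show ?thesis .
  qed
  have "\<theta> T < b"
  proof (rule ccontr)
    assume "\<not> \<theta> T < b"
    then have "\<Phi> b \<le> \<Phi> (\<theta> T)"
      by (intro DERIV_nonneg_imp_nondecreasing[of b "\<theta> T" \<Phi>]) (auto intro!: exI \<Phi> less_imp_le[OF h0])
    then show False using low gap0 by simp
  qed
  then obtain z where z: "\<Phi> b - \<Phi> (\<theta> T) = (b - \<theta> T) * h z"
    using MVT2[of "\<theta> T" b \<Phi> h] \<Phi> by blast
  have "gap \<le> (b - \<theta> T) * h z" using low z by simp
  also have "\<dots> \<le> (b - \<theta> T) * k" using hk \<open>\<theta> T < b\<close> by (intro mult_left_mono) auto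
  finally have "k * (2 * (real n + 1) * \<mu> / L * (pi - 2 * \<delta> - sin (pi - 2 * \<delta>))) \<le> k * (b - \<theta> T)"
    unfolding gap_eq by (simp add: mult.commute)
  then have "2 * (real n + 1) * \<mu> / L * (pi - 2 * \<delta> - sin (pi - 2 * \<delta>)) \<le> b - \<theta> T"
    using k by (simp only: mult_le_cancel_left_pos)
  then show ?thesis by (simp add: b_def)
qed

section \<open>Displacement of the period map\<close>

text \<open>The squared distance is \<open>R\<^sup>2 + r\<^sup>2 - 2 R r cos (b - a)\<close>, and \<open>cos (b - a) \<le> cos \<epsilon>\<close>; minimising over \<open>R\<close>
  leaves \<open>r\<^sup>2 sin\<^sup>2 \<epsilon>\<close>.\<close>

lemma rotated_vector_displacement:
  fixes r R :: real
  assumes r: "r \<ge> 0" and R: "R \<ge> 0" and \<epsilon>: "0 \<le> \<epsilon>" "\<epsilon> \<le> pi"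
    and l: "2 * real n * pi + \<epsilon> \<le> b - a" and u: "b - a \<le> 2 * (real n + 1) * pi - \<epsilon>"
  shows "(r * sin \<epsilon>)\<^sup>2 \<le> (R * sin b - r * sin a)\<^sup>2 + (R * cos b - r * cos a)\<^sup>2"
proof -
  define y where "y = (b - a) - 2 * real n * pi"
  have "b - a = y + 2 * real n * pi" by (simp add: y_def)
  then have y: "cos (b - a) = cos y"
    using cos_2npi[of n] sin_2npi[of n] by (simp add: cos_add)
  have "cos y \<le> cos \<epsilon>"
  proof (cases "y \<le> pi")
    case True
    then show ?thesis using l \<epsilon> by (intro cos_monotone_0_pi_le) (auto simp: y_def)
  next
    case False
    have "cos (2 * pi - y) \<le> cos \<epsilon>"
      using False u \<epsilon> by (intro cos_monotone_0_pi_le) (auto simp: y_def algebra_simps)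
    then show ?thesis by simp
  qed
  then have "2 * (R * r) * cos (b - a) \<le> 2 * (R * r) * cos \<epsilon>"
    unfolding y using r R by (intro mult_left_mono) auto
  moreover have "(R * sin b - r * sin a)\<^sup>2 + (R * cos b - r * cos a)\<^sup>2
      = R\<^sup>2 * ((sin b)\<^sup>2 + (cos b)\<^sup>2) + r\<^sup>2 * ((sin a)\<^sup>2 + (cos a)\<^sup>2) - 2 * (R * r) * cos (b - a)"
    unfolding cos_diff by (simp add: power2_eq_square algebra_simps
          del: sin_cos_squared_add sin_cos_squared_add2 sin_cos_squared_add3)
  moreover have "0 \<le> (R - r * cos \<epsilon>)\<^sup>2" by simp
  moreover have "(R - r * cos \<epsilon>)\<^sup>2 = R\<^sup>2 - 2 * (R * r) * cos \<epsilon> + r\<^sup>2 - (r * sin \<epsilon>)\<^sup>2"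
    by (simp add: power2_diff power_mult_distrib cos_squared_eq algebra_simps)
  ultimately show ?thesis by simp
qed

lemma bounded_measurable_open_interval:
  fixes a :: "real \<Rightarrow> real"
  assumes "Linfty T a"
  shows "integrable (lebesgue_on {0<..<T}) a"
    "(a has_integral (LINT x|lebesgue_on {0<..<T}. a x)) {0..T}"
proof -
  have "finite_measure (lebesgue_on {0<..<T})" by (intro finite_measure_lebesgue_on) simp
  then show i: "integrable (lebesgue_on {0<..<T}) a"
    using assms unfolding Linfty_def real_norm_def[symmetric]
    by (elim conjE exE) (rule finite_measure.integrable_const_bound)
  have "(a has_integral (LINT x|lebesgue_on {0<..<T}. a x)) {0<..<T}"
    by (rule has_integral_integral_lebesgue_on[OF i]) simp
  then show "(a has_integral (LINT x|lebesgue_on {0<..<T}. a x)) {0..T}"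
    using has_integral_open_interval[of a _ 0 T] by simp
qed

text \<open>A nonnegative function with integral zero vanishes almost everywhere.\<close>

lemma integral_above_constant_pos:
  assumes T: "T > 0" and a: "Linfty T a" and below: "strictly_below T (\<lambda>x. l) a"
  shows "integral {0..T} (\<lambda>x. a x - l) > 0"
proof -
  have fin: "finite_measure (lebesgue_on {0<..<T})" by (intro finite_measure_lebesgue_on) simp
  note ai = bounded_measurable_open_interval(1)[OF a]
  have i: "integrable (lebesgue_on {0<..<T}) (\<lambda>x. a x - l)"
    using ai finite_measure.integrable_const[OF fin] by (intro Bochner_Integration.integrable_diff)
  have "AE x in lebesgue. x \<in> {0..T} \<longrightarrow> l \<le> a x"
    using below AE_restrict_space_iff[of "{0..T}" lebesgue "\<lambda>x. l \<le> a x"] by (simp add: strictly_below_def)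
  then have "AE x in lebesgue. x \<in> {0<..<T} \<longrightarrow> 0 \<le> a x - l" by eventually_elim auto
  then have pos: "AE x in lebesgue_on {0<..<T}. 0 \<le> a x - l"
    using AE_restrict_space_iff[of "{0<..<T}" lebesgue "\<lambda>x. 0 \<le> a x - l"] by simp
  have "(LINT x|lebesgue_on {0<..<T}. a x - l) \<noteq> 0"
  proof
    assume "(LINT x|lebesgue_on {0<..<T}. a x - l) = 0"
    then have "AE x in lebesgue_on {0<..<T}. a x - l = 0"
      using integral_nonneg_eq_0_iff_AE[OF i pos] by simp
    then obtain N where N: "negligible N" "0 \<in> N" "T \<in> N" "\<And>x. x \<in> {0..T} - N \<Longrightarrow> a x - l = 0"
      by (rule AE_open_intervalE) (rule that)
    have "{x \<in> {0..T}. l < a x} \<subseteq> N" using N(4) by force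
    then have "negligible {x \<in> {0..T}. l < a x}" using N(1) negligible_subset by blast
    then have "emeasure lebesgue {x \<in> {0..T}. l < a x} = 0" by (simp add: negligible_iff_null_sets null_setsD1)
    then show False using below by (simp add: strictly_below_def)
  qed
  moreover have "(LINT x|lebesgue_on {0<..<T}. a x - l) \<ge> 0" using pos by (rule integral_nonneg_AE)
  moreover have "(LINT x|lebesgue_on {0<..<T}. a x - l) = integral {0..T} (\<lambda>x. a x - l)"
    using lebesgue_integral_eq_integral[OF i] by (simp add: integral_open_interval_real)
  ultimately show ?thesis by simp
qed

text \<open>The mean value theorem, in a form that is insensitive to the order of \<open>u\<close> and \<open>v\<close>.\<close>

lemma monotone_difference_bounds:
  fixes F F' :: "real \<Rightarrow> real"
  assumes d: "\<And>u. (F has_real_derivative F' u) (at u)" and b: "\<And>u. a \<le> F' u \<and> F' u \<le> b"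
  shows "a * (u - v)\<^sup>2 \<le> (F u - F v) * (u - v)" "(F u - F v) * (u - v) \<le> b * (u - v)\<^sup>2"
proof -
  have "\<exists>z. F u - F v = F' z * (u - v)"
  proof -
    consider "u = v" | "u < v" | "v < u" by linarith
    then show ?thesis
    proof cases
      case 2
      then obtain z where "F v - F u = (v - u) * F' z" using MVT2[of u v F F'] d by blast
      then have "F u - F v = F' z * (u - v)" by (simp add: algebra_simps)
      then show ?thesis by blast
    next
      case 3
      then obtain z where "F u - F v = (u - v) * F' z" using MVT2[of v u F F'] d by blast
      then show ?thesis by (auto simp: mult.commute)
    qed simp
  qed
  then obtain z where z: "(F u - F v) * (u - v) = F' z * (u - v)\<^sup>2" by (auto simp: power2_eq_square)
  show "a * (u - v)\<^sup>2 \<le> (F u - F v) * (u - v)" "(F u - F v) * (u - v) \<le> b * (u - v)\<^sup>2"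
    unfolding z using b by (auto intro: mult_right_mono)
qed

lemma monotone_difference_lipschitz:
  fixes F F' :: "real \<Rightarrow> real"
  assumes d: "\<And>u. (F has_real_derivative F' u) (at u)" and b: "\<And>u. 0 \<le> F' u \<and> F' u \<le> K"
  shows "\<bar>F u - F v\<bar> \<le> K * \<bar>u - v\<bar>"
proof (cases "u = v")
  case False
  have "0 * (u - v)\<^sup>2 \<le> (F u - F v) * (u - v)" and up: "(F u - F v) * (u - v) \<le> K * (u - v)\<^sup>2"
    by (rule monotone_difference_bounds[OF d b])+
  then have "\<bar>F u - F v\<bar> * \<bar>u - v\<bar> = (F u - F v) * (u - v)" by (simp add: abs_mult[symmetric])
  also have "\<dots> \<le> (K * \<bar>u - v\<bar>) * \<bar>u - v\<bar>" using up by (simp add: power2_eq_square mult.assoc)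
  finally show ?thesis using False by simp
qed simp

text \<open>The phase vector of the difference of two solutions rotates by an angle between \<open>2 n \<pi> + \<epsilon>\<close> and
  \<open>2 (n + 1) \<pi> - \<epsilon>\<close>, and \<open>c = sin \<epsilon>\<close> works by \<open>rotated_vector_displacement\<close>. All angular velocities are
  at most \<open>L = \<mu> + K / \<mu>\<close>.\<close>

lemma displacement_bound:
  fixes f fu :: "real \<Rightarrow> real \<Rightarrow> real" and \<alpha> \<beta> :: "real \<Rightarrow> real"
  assumes T: "T > 0" and n: "n \<ge> 1" and \<mu>_def: "\<mu> = 2 * real n * pi / T"
    and \<delta>_def: "\<delta> = real n * pi / (2 * (real n + 1))"
    and N: "negligible N" and K: "K \<ge> 0"
    and lip: "\<And>x u v. x \<in> {0..T} - N \<Longrightarrow> \<bar>f x u - f x v\<bar> \<le> K * \<bar>u - v\<bar>"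
    and lo: "\<And>x u v. x \<in> {0..T} - N \<Longrightarrow> \<alpha> x * (u - v)\<^sup>2 \<le> (f x u - f x v) * (u - v)"
    and hi: "\<And>x u v. x \<in> {0..T} - N \<Longrightarrow> (f x u - f x v) * (u - v) \<le> \<beta> x * (u - v)\<^sup>2"
    and \<mu>\<alpha>: "\<And>x. x \<in> {0..T} - N \<Longrightarrow> \<mu>\<^sup>2 \<le> \<alpha> x"
    and \<mu>\<beta>: "\<And>x. x \<in> {0..T} - N \<Longrightarrow> \<mu>\<^sup>2 \<le> \<beta> x \<and> \<beta> x \<le> K"
    and \<alpha>_int: "(\<lambda>x. \<alpha> x - \<mu>\<^sup>2) integrable_on {0..T}" "integral {0..T} (\<lambda>x. \<alpha> x - \<mu>\<^sup>2) > 0"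
    and \<beta>_int: "((\<lambda>x. \<beta> x - \<mu>\<^sup>2) has_integral I) {0..T}" "I \<le> 4 * (real n + 1) * \<mu> * cot \<delta>"
  obtains c where "c > 0"
    "\<And>u u' v v'. ode_solution T f u u' \<Longrightarrow> ode_solution T f v v' \<Longrightarrow>
       c\<^sup>2 * ((u 0 - v 0)\<^sup>2 + ((u' 0 - v' 0) / \<mu>)\<^sup>2)
         \<le> ((u T - v T) - (u 0 - v 0))\<^sup>2 + ((u' T - v' T) / \<mu> - (u' 0 - v' 0) / \<mu>)\<^sup>2"
proof -
  have \<mu>: "\<mu> > 0" using T n by (simp add: \<mu>_def)
  define L where "L = \<mu> + K / \<mu>"
  have L: "\<mu> \<le> L" using \<mu> K by (simp add: L_def)
  have A0: "0 \<le> \<alpha> x - \<mu>\<^sup>2" if "x \<in> {0..T} - N" for x using \<mu>\<alpha>[OF that] by simp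
  obtain \<epsilon>0 where \<epsilon>0: "\<epsilon>0 > 0" and excess: "\<And>\<theta> g N'. lip_deriv T \<theta> g \<Longrightarrow> negligible N' \<Longrightarrow>
       (\<And>x. x \<in> {0..T} - N' \<Longrightarrow> \<mu> + (\<alpha> x - \<mu>\<^sup>2) / \<mu> * (sin (\<theta> x))\<^sup>2 \<le> g x \<and> g x \<le> L) \<Longrightarrow>
       \<theta> T - \<theta> 0 \<ge> \<mu> * T + \<epsilon>0"
    using rotation_excess[OF T \<mu> \<alpha>_int N A0, where L=L] by blast
  define \<epsilon>1 where "\<epsilon>1 = 2 * (real n + 1) * \<mu> / L * (pi - 2 * \<delta> - sin (pi - 2 * \<delta>))"
  have \<delta>: "0 < \<delta>" "\<delta> < pi / 2" using n by (auto simp: \<delta>_def field_simps)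
  have "pi - 2 * \<delta> - sin (pi - 2 * \<delta>) > 0" using sin_less_self[of "pi - 2 * \<delta>"] \<delta> by simp
  then have \<epsilon>1: "\<epsilon>1 > 0" unfolding \<epsilon>1_def using \<mu> L by (intro mult_pos_pos divide_pos_pos) auto
  define \<epsilon> where "\<epsilon> = min (min \<epsilon>0 \<epsilon>1) (pi / 2)"
  have \<epsilon>: "0 < \<epsilon>" "\<epsilon> \<le> pi / 2" "\<epsilon> \<le> \<epsilon>0" "\<epsilon> \<le> \<epsilon>1" using \<epsilon>0 \<epsilon>1 by (auto simp: \<epsilon>_def)
  have "sin \<epsilon> > 0" using \<epsilon> pi_gt_zero by (intro sin_gt_zero) auto
  then show thesis
  proof (rule that)
    fix u u' v v' assume u: "ode_solution T f u u'" and v: "ode_solution T f v v'"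
    define w where "w x = u x - v x" for x
    define z where "z x = (u' x - v' x) / \<mu>" for x
    obtain d N' where N': "negligible N'" "N \<subseteq> N'"
      and W: "lip_deriv T (\<lambda>x. u x - v x) (\<lambda>x. u' x - v' x)"
      and Z: "lip_deriv T (\<lambda>x. u' x - v' x) d"
      and db: "\<And>x. x \<in> {0..T} \<Longrightarrow> \<bar>d x\<bar> \<le> K * \<bar>u x - v x\<bar>"
      and de: "\<And>x. x \<in> {0..T} - N' \<Longrightarrow> d x = - (f x (u x) - f x (v x))"
      by (rule ode_difference[OF N K lip u v]) (assumption+, (rule that; assumption))
    have inN: "x \<in> {0..T} - N" if "x \<in> {0..T} - N'" for x using that N'(2) by blast
    have w: "lip_deriv T w (\<lambda>x. \<mu> * z x)"
      using W \<mu> by (simp add: w_def[abs_def] z_def)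
    have z: "lip_deriv T z (\<lambda>x. d x / \<mu>)"
      using lip_deriv_cmult[OF Z, of "1 / \<mu>"] by (simp add: z_def[abs_def])
    have "(sin \<epsilon>)\<^sup>2 * ((w 0)\<^sup>2 + (z 0)\<^sup>2) \<le> (w T - w 0)\<^sup>2 + (z T - z 0)\<^sup>2"
    proof (cases "(w 0)\<^sup>2 + (z 0)\<^sup>2 > 0")
      case True
      define r0 where "r0 = sqrt ((w 0)\<^sup>2 + (z 0)\<^sup>2)"
      have ab: "\<alpha> x * (w x)\<^sup>2 \<le> - (\<mu> * (d x / \<mu>) * w x) \<and> - (\<mu> * (d x / \<mu>) * w x) \<le> \<beta> x * (w x)\<^sup>2"
        if "x \<in> {0..T} - N'" for x
      proof -
        have "\<mu> * (d x / \<mu>) = d x" using \<mu> by simp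
        then have "- (\<mu> * (d x / \<mu>) * w x) = (f x (u x) - f x (v x)) * (u x - v x)"
          unfolding w_def de[OF that] by (simp only: mult_minus_left minus_minus)
        then show ?thesis using lo[OF inN[OF that]] hi[OF inN[OF that]] by (simp add: w_def)
      qed
      obtain \<theta> g r where \<theta>: "lip_deriv T \<theta> g" and r: "r > 0"
        and w0: "w 0 = r0 * sin (\<theta> 0)" and z0: "z 0 = r0 * cos (\<theta> 0)"
        and wT: "w T = r * sin (\<theta> T)" and zT: "z T = r * cos (\<theta> T)"
        and gl: "\<And>x. x \<in> {0..T} - N' \<Longrightarrow> \<mu> + (\<alpha> x - \<mu>\<^sup>2) / \<mu> * (sin (\<theta> x))\<^sup>2 \<le> g x"
        and gu: "\<And>x. x \<in> {0..T} - N' \<Longrightarrow> g x \<le> \<mu> + (\<beta> x - \<mu>\<^sup>2) / \<mu> * (sin (\<theta> x))\<^sup>2"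
        unfolding r0_def
        by (rule pruefer_angle[OF \<mu> K less_imp_le[OF T] w z _ N'(1) ab True])
          (use db \<mu> in \<open>auto simp: w_def\<close>)
      have gL: "g x \<le> L" if x: "x \<in> {0..T} - N'" for x
      proof -
        have b: "\<mu>\<^sup>2 \<le> \<beta> x" "\<beta> x \<le> K" using \<mu>\<beta>[OF inN[OF x]] by auto
        have "(\<beta> x - \<mu>\<^sup>2) / \<mu> * (sin (\<theta> x))\<^sup>2 \<le> (\<beta> x - \<mu>\<^sup>2) / \<mu> * 1"
          using b \<mu> by (intro mult_left_mono) (auto simp: abs_square_le_1)
        also have "\<dots> \<le> K / \<mu>" using b \<mu> by (simp add: divide_right_mono order_trans[OF _ b(2)])
        finally show ?thesis using gu[OF x] by (simp add: L_def)
      qed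
      have g0: "0 \<le> g x" if x: "x \<in> {0..T} - N'" for x
      proof -
        have "0 \<le> (\<alpha> x - \<mu>\<^sup>2) / \<mu> * (sin (\<theta> x))\<^sup>2" using A0[OF inN[OF x]] \<mu> by simp
        then show ?thesis using gl[OF x] \<mu> by simp
      qed
      have "\<mu> * T + \<epsilon>0 \<le> \<theta> T - \<theta> 0" using excess[OF \<theta> N'(1)] gl gL by blast
      moreover have "\<mu> * T = 2 * real n * pi" using T by (simp add: \<mu>_def)
      ultimately have l: "2 * real n * pi + \<epsilon> \<le> \<theta> T - \<theta> 0" using \<epsilon> by simp
      have "\<theta> T - \<theta> 0 \<le> 2 * (real n + 1) * pi - \<epsilon>1"
        unfolding \<epsilon>1_def
        by (rule rotation_deficit[OF T n \<mu>_def L \<delta>_def \<beta>_int \<theta> N'(1)])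
          (use \<mu>\<beta> N' g0 gL gu in \<open>auto simp: subset_iff\<close>)
      then have h: "\<theta> T - \<theta> 0 \<le> 2 * (real n + 1) * pi - \<epsilon>" using \<epsilon> by simp
      have "(r0 * sin \<epsilon>)\<^sup>2 \<le> (w T - w 0)\<^sup>2 + (z T - z 0)\<^sup>2"
        unfolding w0 z0 wT zT
        by (rule rotated_vector_displacement[OF _ _ _ _ l h]) (use r True \<epsilon> in \<open>auto simp: r0_def\<close>)
      moreover have "(r0 * sin \<epsilon>)\<^sup>2 = (sin \<epsilon>)\<^sup>2 * ((w 0)\<^sup>2 + (z 0)\<^sup>2)"
        using True by (simp add: r0_def power_mult_distrib)
      ultimately show ?thesis by simp
    next
      case False
      then have "(w 0)\<^sup>2 + (z 0)\<^sup>2 = 0" by (simp add: not_less sum_power2_le_zero_iff)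
      then show ?thesis by (simp only: mult_zero_right) simp
    qed
    then show "(sin \<epsilon>)\<^sup>2 * ((u 0 - v 0)\<^sup>2 + ((u' 0 - v' 0) / \<mu>)\<^sup>2)
         \<le> ((u T - v T) - (u 0 - v 0))\<^sup>2 + ((u' T - v' T) / \<mu> - (u' 0 - v' 0) / \<mu>)\<^sup>2"
      by (simp add: w_def z_def)
  qed
qed

lemma ode_stability:
  assumes \<mu>: "\<mu> > 0" and N: "negligible N" and K: "K \<ge> 0"
    and lip: "\<And>x u v. x \<in> {0..T} - N \<Longrightarrow> \<bar>f x u - f x v\<bar> \<le> K * \<bar>u - v\<bar>"
    and u: "ode_solution T f u u'" and v: "ode_solution T f v v'" and t: "0 \<le> t" "t \<le> T"
  shows "(u t - v t)\<^sup>2 + ((u' t - v' t) / \<mu>)\<^sup>2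
    \<le> exp ((\<mu> + K / \<mu>) * t) * ((u 0 - v 0)\<^sup>2 + ((u' 0 - v' 0) / \<mu>)\<^sup>2)"
proof -
  obtain d N' where W: "lip_deriv T (\<lambda>x. u x - v x) (\<lambda>x. u' x - v' x)"
    and Z: "lip_deriv T (\<lambda>x. u' x - v' x) d"
    and db: "\<And>x. x \<in> {0..T} \<Longrightarrow> \<bar>d x\<bar> \<le> K * \<bar>u x - v x\<bar>"
    by (rule ode_difference[OF N K lip u v]) (assumption+, (rule that; assumption))
  show ?thesis
  proof (rule energy_gronwall(1)[OF \<mu> K _ _ _ t])
    show "lip_deriv T (\<lambda>x. u x - v x) (\<lambda>x. \<mu> * ((u' x - v' x) / \<mu>))" using W \<mu> by simp
    show "lip_deriv T (\<lambda>x. (u' x - v' x) / \<mu>) (\<lambda>x. d x / \<mu>)"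
      using lip_deriv_cmult[OF Z, of "1 / \<mu>"] by simp
  qed (use db \<mu> in auto)
qed

section \<open>Existence and uniqueness of the periodic solution\<close>

text \<open>The range is open by invariance of domain. It is closed because preimages of a convergent
  sequence form a Cauchy sequence. The space is connected.\<close>

lemma continuous_expansive_surj:
  fixes F :: "'a::euclidean_space \<Rightarrow> 'a"
  assumes cont: "continuous_on UNIV F" and c: "c > 0"
    and exp: "\<And>x y. c * dist x y \<le> dist (F x) (F y)"
  shows "surj F"
proof -
  have inj: "inj F"
  proof (rule injI)
    fix x y assume "F x = F y"
    then have "c * dist x y \<le> 0" using exp[of x y] by simp
    then have "dist x y \<le> 0" using c by (simp add: mult_le_0_iff)
    then show "x = y" by simp
  qed
  have "open (range F)" by (rule invariance_of_domain[OF cont open_UNIV inj])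
  moreover have "closed (range F)"
    unfolding closed_sequential_limits
  proof (intro allI impI, elim conjE)
    fix Y l assume Y: "\<forall>k. Y k \<in> range F" "Y \<longlonglongrightarrow> l"
    then have "\<forall>k. \<exists>x. Y k = F x" by blast
    then obtain X where X: "\<And>k. Y k = F (X k)" by metis
    have "Cauchy X"
    proof (rule metric_CauchyI)
      fix e :: real assume "e > 0"
      then have "c * e > 0" using c by simp
      then obtain M where M: "\<And>m n. m \<ge> M \<Longrightarrow> n \<ge> M \<Longrightarrow> dist (Y m) (Y n) < c * e"
        using LIMSEQ_imp_Cauchy[OF Y(2)] metric_CauchyD by meson
      have "dist (X m) (X n) < e" if "m \<ge> M" "n \<ge> M" for m n
      proof -
        have "c * dist (X m) (X n) < c * e" using exp[of "X m" "X n"] M[OF that] X by simp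
        then show ?thesis using c by simp
      qed
      then show "\<exists>M. \<forall>m\<ge>M. \<forall>n\<ge>M. dist (X m) (X n) < e" by blast
    qed
    then obtain x where "X \<longlonglongrightarrow> x" using Cauchy_convergent_iff convergent_def by blast
    then have "(\<lambda>k. F (X k)) \<longlonglongrightarrow> F x"
      using cont by (intro isCont_tendsto_compose[of x F]) (auto simp: continuous_on_eq_continuous_at)
    moreover have "Y = (\<lambda>k. F (X k))" using X by (rule ext)
    ultimately have "l = F x" using LIMSEQ_unique[OF Y(2), of "F x"] by simp
    then show "l \<in> range F" by simp
  qed
  ultimately show ?thesis using clopen[of "range F"] by auto
qed

theorem theorem4p5:
  fixes T :: real and n :: nat
    and f fu :: "real \<Rightarrow> real \<Rightarrow> real"
    and \<alpha> \<beta> :: "real \<Rightarrow> real"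
  assumes "T > 0" and "n \<ge> 1"
    and f_deriv: "\<And>x u. (f x has_real_derivative fu x u) (at u)"
    and f_car: "caratheodory_fun f"
    and fu_car: "caratheodory_fun fu"
    and f_per: "\<And>x u. f (x + T) u = f x u"
    and \<alpha>_Linfty: "Linfty T \<alpha>"
    and \<beta>_Linfty: "Linfty T \<beta>"
    and \<alpha>_lower: "strictly_below T (\<lambda>x. lam_odd T n) \<alpha>"
    and fu_bounds: "AE x in lebesgue_on {0<..<T}. \<forall>u. \<alpha> x \<le> fu x u \<and> fu x u \<le> \<beta> x"
    and \<beta>_norm: "L1_norm T \<beta> \<le> gamma1 T n"
  shows "(\<exists>u. periodic_solution T f u) \<and>
    (\<forall>u v. periodic_solution T f u \<longrightarrow> periodic_solution T f v \<longrightarrow> (\<forall>x\<in>{0..T}. u x = v x))"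
proof -
  note T = \<open>T > 0\<close> and n = \<open>n \<ge> 1\<close>
  define \<mu> where "\<mu> = 2 * real n * pi / T"
  define \<delta> where "\<delta> = real n * pi / (2 * (real n + 1))"
  have \<mu>: "\<mu> > 0" using T n by (simp add: \<mu>_def)
  have lam: "lam_odd T n = \<mu>\<^sup>2" by (simp add: lam_odd_def \<mu>_def power_divide power_mult_distrib)
  have gam: "gamma1 T n = T * \<mu>\<^sup>2 + 4 * (real n + 1) * \<mu> * cot \<delta>"
    unfolding gamma1_def lam \<delta>_def by (simp add: \<mu>_def)
  obtain C where C: "AE x in lebesgue_on {0<..<T}. \<bar>\<beta> x\<bar> \<le> C"
    using \<beta>_Linfty by (auto simp: Linfty_def)
  have "AE x in lebesgue. x \<in> {0..T} \<longrightarrow> \<mu>\<^sup>2 \<le> \<alpha> x"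
    using \<alpha>_lower AE_restrict_space_iff[of "{0..T}" lebesgue "\<lambda>x. \<mu>\<^sup>2 \<le> \<alpha> x"]
    by (simp add: strictly_below_def lam)
  then have "AE x in lebesgue. x \<in> {0<..<T} \<longrightarrow> \<mu>\<^sup>2 \<le> \<alpha> x" by eventually_elim auto
  then have "AE x in lebesgue_on {0<..<T}. \<mu>\<^sup>2 \<le> \<alpha> x"
    using AE_restrict_space_iff[of "{0<..<T}" lebesgue "\<lambda>x. \<mu>\<^sup>2 \<le> \<alpha> x"] by simp
  with C fu_bounds have "AE x in lebesgue_on {0<..<T}.
      \<mu>\<^sup>2 \<le> \<alpha> x \<and> \<bar>\<beta> x\<bar> \<le> C \<and> (\<forall>u. \<alpha> x \<le> fu x u \<and> fu x u \<le> \<beta> x)"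
    by eventually_elim simp
  then obtain N where N: "negligible N" "0 \<in> N" "T \<in> N"
    and ae: "\<And>x. x \<in> {0..T} - N \<Longrightarrow>
      \<mu>\<^sup>2 \<le> \<alpha> x \<and> \<bar>\<beta> x\<bar> \<le> C \<and> (\<forall>u. \<alpha> x \<le> fu x u \<and> fu x u \<le> \<beta> x)"
    by (rule AE_open_intervalE) (rule that)
  \<comment> \<open>The absolute value gives \<open>K \<ge> 0\<close> without evaluating a bound at a point of the interval.\<close>
  define K where "K = \<bar>C\<bar>"
  have K: "K \<ge> 0" by (simp add: K_def)
  have \<mu>\<alpha>: "\<mu>\<^sup>2 \<le> \<alpha> x" if "x \<in> {0..T} - N" for x using ae[OF that] by blast
  have fub: "\<alpha> x \<le> fu x u \<and> fu x u \<le> \<beta> x" if "x \<in> {0..T} - N" for x u using ae[OF that] by blast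
  have \<mu>\<beta>: "\<mu>\<^sup>2 \<le> \<beta> x \<and> \<beta> x \<le> K" if "x \<in> {0..T} - N" for x
    using ae[OF that] fub[OF that, of 0] by (auto simp: K_def)
  have fuK: "0 \<le> fu x u \<and> fu x u \<le> K" if "x \<in> {0..T} - N" for x u
    using \<mu>\<alpha>[OF that] fub[OF that, of u] \<mu>\<beta>[OF that] zero_le_power2[of \<mu>] by linarith
  have lip: "\<bar>f x u - f x v\<bar> \<le> K * \<bar>u - v\<bar>" if "x \<in> {0..T} - N" for x u v
    by (rule monotone_difference_lipschitz[OF f_deriv fuK[OF that]])
  have lo: "\<alpha> x * (u - v)\<^sup>2 \<le> (f x u - f x v) * (u - v)"
    and hi: "(f x u - f x v) * (u - v) \<le> \<beta> x * (u - v)\<^sup>2" if "x \<in> {0..T} - N" for x u v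
    by (rule monotone_difference_bounds[OF f_deriv fub[OF that]])+
  have \<alpha>i: "(\<lambda>x. \<alpha> x - \<mu>\<^sup>2) integrable_on {0..T}"
    using bounded_measurable_open_interval(2)[OF \<alpha>_Linfty]
    by (intro integrable_diff) (auto simp: integrable_on_def[of \<alpha>])
  have \<alpha>p: "integral {0..T} (\<lambda>x. \<alpha> x - \<mu>\<^sup>2) > 0"
    by (rule integral_above_constant_pos[OF T \<alpha>_Linfty \<alpha>_lower[unfolded lam]])
  define I where "I = (LINT x|lebesgue_on {0<..<T}. \<beta> x) - \<mu>\<^sup>2 * (T - 0)"
  have \<beta>i: "((\<lambda>x. \<beta> x - \<mu>\<^sup>2) has_integral I) {0..T}"
    unfolding I_def using T
    by (intro has_integral_diff bounded_measurable_open_interval(2)[OF \<beta>_Linfty] has_integral_const_Icc) simp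
  have "(LINT x|lebesgue_on {0<..<T}. \<beta> x) \<le> L1_norm T \<beta>"
    unfolding L1_norm_def using bounded_measurable_open_interval(1)[OF \<beta>_Linfty]
    by (intro integral_mono) auto
  then have Ib: "I \<le> 4 * (real n + 1) * \<mu> * cot \<delta>"
    using \<beta>_norm by (simp add: I_def gam mult.commute)
  obtain c where c: "c > 0" and disp: "\<And>u u' v v'. ode_solution T f u u' \<Longrightarrow> ode_solution T f v v' \<Longrightarrow>
       c\<^sup>2 * ((u 0 - v 0)\<^sup>2 + ((u' 0 - v' 0) / \<mu>)\<^sup>2)
         \<le> ((u T - v T) - (u 0 - v 0))\<^sup>2 + ((u' T - v' T) / \<mu> - (u' 0 - v' 0) / \<mu>)\<^sup>2"
    by (rule displacement_bound[OF T n \<mu>_def \<delta>_def N(1) K lip lo hi \<mu>\<alpha> \<mu>\<beta> \<alpha>i \<alpha>p \<beta>i Ib]) (assumption+, (rule that; assumption))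
  have uniq: "u x = v x" if u: "periodic_solution T f u" and v: "periodic_solution T f v"
    and x: "x \<in> {0..T}" for u v x
  proof -
    from u obtain u' where u': "ode_solution T f u u'" "u 0 = u T" "u' 0 = u' T"
      by (auto simp: periodic_solution_iff)
    from v obtain v' where v': "ode_solution T f v v'" "v 0 = v T" "v' 0 = v' T"
      by (auto simp: periodic_solution_iff)
    define e where "e = (u 0 - v 0)\<^sup>2 + ((u' 0 - v' 0) / \<mu>)\<^sup>2"
    have "c\<^sup>2 * e \<le> 0" using disp[OF u'(1) v'(1)] u' v' by (simp add: e_def)
    then have "e \<le> 0" using c by (simp add: mult_le_0_iff)
    moreover have "e \<ge> 0" by (simp add: e_def)
    ultimately have "e = 0" by simp
    then have "(u x - v x)\<^sup>2 + ((u' x - v' x) / \<mu>)\<^sup>2 \<le> 0"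
      using ode_stability[OF \<mu> N(1) K lip u'(1) v'(1), of x, folded e_def] x by simp
    then show ?thesis by (simp add: sum_power2_le_zero_iff)
  qed
  have meas: "(\<lambda>x. f x u) \<in> borel_measurable lebesgue" for u
    using f_car by (simp add: caratheodory_fun_def)
  have cont: "continuous_on UNIV (f x)" for x
    using f_deriv by (intro DERIV_continuous_on) (auto intro: has_field_derivative_at_within)
  have f0: "(\<lambda>x. f x 0) absolutely_integrable_on {0..T}"
  proof -
    obtain h where h: "\<forall>a b. set_integrable lebesgue {a..b} h" "AE x in lebesgue. \<forall>u. \<bar>u\<bar> \<le> 1 \<longrightarrow> \<bar>f x u\<bar> \<le> h x"
      using f_car unfolding caratheodory_fun_def by (meson zero_less_one)
    show ?thesis
    proof (rule set_integrable_bound[of _ _ h])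
      show "set_integrable lebesgue {0..T} h" using h(1) by blast
      show "set_borel_measurable lebesgue {0..T} (\<lambda>x. f x 0)"
        unfolding set_borel_measurable_def by (intro borel_measurable_scaleR borel_measurable_indicator meas) simp
      show "AE x in lebesgue. x \<in> {0..T} \<longrightarrow> norm (f x 0) \<le> norm (h x)"
        using h(2)
      proof eventually_elim
        case (elim x)
        then have "\<bar>f x 0\<bar> \<le> h x" by simp
        then show ?case by simp
      qed
    qed
  qed
  have "\<exists>u u'. ode_solution T f u u' \<and> u 0 = Re \<xi> \<and> u' 0 = \<mu> * Im \<xi>" for \<xi>
    by (rule ivp_solvable[OF less_imp_le[OF T] meas cont N(1) K lip f0, of "Re \<xi>" "\<mu> * Im \<xi>"]) blast+
  then obtain U U' where U: "\<And>\<xi>. ode_solution T f (U \<xi>) (U' \<xi>)"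
    "\<And>\<xi>. U \<xi> 0 = Re \<xi>" "\<And>\<xi>. U' \<xi> 0 = \<mu> * Im \<xi>" by metis
  \<comment> \<open>The displacement of the phase vector with the initial value \<open>\<xi> = Complex (u 0) (u' 0 / \<mu>)\<close> during
    one period.\<close>
  define F where "F \<xi> = Complex (U \<xi> T - Re \<xi>) (U' \<xi> T / \<mu> - Im \<xi>)" for \<xi>
  have dist_sq: "(dist \<xi> \<eta>)\<^sup>2 = (U \<xi> 0 - U \<eta> 0)\<^sup>2 + ((U' \<xi> 0 - U' \<eta> 0) / \<mu>)\<^sup>2" for \<xi> \<eta>
    using \<mu> by (simp add: dist_norm cmod_power2 U diff_divide_distrib)
  have distF_sq: "(dist (F \<xi>) (F \<eta>))\<^sup>2 = ((U \<xi> T - U \<eta> T) - (U \<xi> 0 - U \<eta> 0))\<^sup>2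
      + ((U' \<xi> T - U' \<eta> T) / \<mu> - (U' \<xi> 0 - U' \<eta> 0) / \<mu>)\<^sup>2" for \<xi> \<eta>
    using \<mu> by (simp add: F_def dist_norm cmod_power2 U diff_divide_distrib algebra_simps)
  have expansive: "c * dist \<xi> \<eta> \<le> dist (F \<xi>) (F \<eta>)" for \<xi> \<eta>
  proof (rule power2_le_imp_le)
    show "(c * dist \<xi> \<eta>)\<^sup>2 \<le> (dist (F \<xi>) (F \<eta>))\<^sup>2"
      unfolding distF_sq unfolding power_mult_distrib dist_sq by (rule disp[OF U(1) U(1)])
  qed simp
  define M where "M = 2 * (exp ((\<mu> + K / \<mu>) * T) + 1)"
  have "M > 0" by (simp add: M_def add_pos_pos)
  have lipF: "dist (F \<xi>) (F \<eta>) \<le> sqrt M * dist \<xi> \<eta>" for \<xi> \<eta>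
  proof (rule power2_le_imp_le)
    have sq: "(a - b)\<^sup>2 + (p - q)\<^sup>2 \<le> 2 * (a\<^sup>2 + p\<^sup>2) + 2 * (b\<^sup>2 + q\<^sup>2)" for a b p q :: real
      using zero_le_power2[of "a + b"] zero_le_power2[of "p + q"]
      by (simp add: power2_eq_square algebra_simps)
    have "(dist (F \<xi>) (F \<eta>))\<^sup>2 \<le> 2 * ((U \<xi> T - U \<eta> T)\<^sup>2 + ((U' \<xi> T - U' \<eta> T) / \<mu>)\<^sup>2) + 2 * (dist \<xi> \<eta>)\<^sup>2"
      unfolding distF_sq unfolding dist_sq by (rule sq)
    also have "\<dots> \<le> 2 * (exp ((\<mu> + K / \<mu>) * T) * (dist \<xi> \<eta>)\<^sup>2) + 2 * (dist \<xi> \<eta>)\<^sup>2"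
      unfolding dist_sq using T
      by (intro add_right_mono mult_left_mono ode_stability[OF \<mu> N(1) K lip U(1) U(1)]) auto
    also have "\<dots> = (sqrt M * dist \<xi> \<eta>)\<^sup>2"
      using \<open>M > 0\<close> by (simp add: power_mult_distrib) (simp add: M_def algebra_simps)
    finally show "(dist (F \<xi>) (F \<eta>))\<^sup>2 \<le> (sqrt M * dist \<xi> \<eta>)\<^sup>2" .
  qed (use \<open>M > 0\<close> in simp)
  have "continuous_on UNIV F"
    by (rule lipschitz_on_continuous_on[of "sqrt M"], rule lipschitz_onI)
      (use lipF \<open>M > 0\<close> in auto)
  then have "surj F" using c expansive by (rule continuous_expansive_surj)
  then obtain \<xi> where "F \<xi> = 0" by (metis surjD)
  then have "U \<xi> T = Re \<xi>" "U' \<xi> T = \<mu> * Im \<xi>"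
    using \<mu> by (auto simp: F_def complex_eq_iff field_simps)
  then have "periodic_solution T f (U \<xi>)"
    unfolding periodic_solution_iff using U[of \<xi>] by auto
  then show ?thesis using uniq by blast
qed

end
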